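(* Let $K$ be a field and let $G$ be a finite simple connected graph. Then the toric ring $R_G$ of the cut ideal of $G$ is strongly Koszul if and only if $G$ has neither $K_4$ nor $C_5$ as a minor.
   Context: Let $G$ be a finite simple graph with vertex set $V(G)$ and edge set $E(G)$. For each unordered partition $A|B$ of $V(G)$ (that is, $A\cap B=\emptyset$, $A\cup B=V(G)$, possibly with $A$ or $B$ empty, and $A|B=B|A$) take a variable $q_{A|B}$, and let $K[q]$ be the polynomial ring over $K$ in these $2^{|V(G)|-1}$ variables. Let $K[s,T]=K[s,t_{ij}\mid ij\in E(G)]$. Define the $K$-algebra homomorphism $\pi_G:K[q]\to K[s,T]$ by $\pi_G(q_{A|B})=u_{A|B}:=s\cdot\prod_{ij\in E(G),\ |A\cap\{i,j\}|=1}t_{ij}$. The cut ideal $I_G$ is $\ker\pi_G$, and the toric ring $R_G$ is the image of $\pi_G$, i.e. the $K$-subalgebra of $K[s,T]$ generated by the monomials $u_{A|B}$, graded so that each $u_{A|B}$ has degree $1$ (degree in $s$). A semigroup ring $R$ generated by (distinct) monomials $u_1,\dots,u_n$, each of degree $1$, is called strongly Koszul if for all $i\neq j$ the ideal $(u_i)\cap(u_j)$ of $R$ is generated in degree $2$. $K_4$ is the complete graph on 4 vertices and $C_5$ is the cycle of length 5. A graph $H$ is a minor of $G$ if (up to isomorphism) $H$ can be obtained from $G$ by deleting and contracting edges (after a contraction, loops are removed and parallel edges are identified). *)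

theory Defs
  imports "HOL-Library.Poly_Mapping" "HOL-Algebra.Algebraic_Closure_Type"
begin

section \<open>Simple graphs and minors\<close>

type_synonym 'v ugraph = "'v set \<times> 'v set set"

abbreviation verts :: "'v ugraph \<Rightarrow> 'v set" where "verts G \<equiv> fst G"
abbreviation edges :: "'v ugraph \<Rightarrow> 'v set set" where "edges G \<equiv> snd G"

definition fin_simple_graph :: "'v ugraph \<Rightarrow> bool" where
  "fin_simple_graph G \<longleftrightarrow> finite (verts G) \<and> (\<forall>e\<in>edges G. e \<subseteq> verts G \<and> card e = 2)"

definition connected_graph :: "'v ugraph \<Rightarrow> bool" where
  "connected_graph G \<longleftrightarrow> verts G \<noteq> {} \<and>
     (\<forall>x\<in>verts G. \<forall>y\<in>verts G. (x, y) \<in> {(a, b). {a, b} \<in> edges G}\<^sup>*)"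

definition graph_iso :: "'v ugraph \<Rightarrow> 'w ugraph \<Rightarrow> bool" where
  "graph_iso G H \<longleftrightarrow> (\<exists>f. bij_betw f (verts G) (verts H) \<and> (\<lambda>e. f ` e) ` edges G = edges H)"

text \<open>Contracting the edge \<open>{x, y}\<close> renames \<open>y\<close> to \<open>x\<close>.  Parallel edges are identified because
  the edges form a set of vertex sets; an edge that becomes a loop is a singleton afterwards and is
  removed by the condition on the cardinality.\<close>

definition contract_edge :: "'v \<Rightarrow> 'v \<Rightarrow> 'v ugraph \<Rightarrow> 'v ugraph" where
  "contract_edge x y G =
     (verts G - {y}, {e \<in> (\<lambda>e. (\<lambda>z. if z = y then x else z) ` e) ` edges G. card e = 2})"

definition delete_edge :: "'v set \<Rightarrow> 'v ugraph \<Rightarrow> 'v ugraph" where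
  "delete_edge e G = (verts G, edges G - {e})"

inductive reduces_to :: "'v ugraph \<Rightarrow> 'v ugraph \<Rightarrow> bool" for G :: "'v ugraph" where
  refl: "reduces_to G G"
| delete: "reduces_to G H \<Longrightarrow> e \<in> edges H \<Longrightarrow> reduces_to G (delete_edge e H)"
| contract: "reduces_to G H \<Longrightarrow> {x, y} \<in> edges H \<Longrightarrow> x \<noteq> y \<Longrightarrow> reduces_to G (contract_edge x y H)"

definition is_minor :: "'w ugraph \<Rightarrow> 'v ugraph \<Rightarrow> bool" where
  "is_minor H G \<longleftrightarrow> (\<exists>G'. reduces_to G G' \<and> graph_iso G' H)"

definition complete_graph :: "nat \<Rightarrow> nat ugraph" where
  "complete_graph n = ({..<n}, {e. e \<subseteq> {..<n} \<and> card e = 2})"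

definition cycle_graph :: "nat \<Rightarrow> nat ugraph" where
  "cycle_graph n = ({..<n}, {{i, (i + 1) mod n} | i. i < n})"


section \<open>Polynomial rings\<close>

text \<open>Polynomials with coefficients in \<open>'k\<close> and indeterminates in \<open>'x\<close>: finitely supported
  functions from monomials (finitely supported exponent functions) to coefficients.\<close>

type_synonym ('x, 'k) mpoly = "('x \<Rightarrow>\<^sub>0 nat) \<Rightarrow>\<^sub>0 'k"

definition Const :: "'k::zero \<Rightarrow> ('x, 'k) mpoly" where
  "Const c = Poly_Mapping.single 0 c"

definition Var :: "'x \<Rightarrow> ('x, 'k::zero_neq_one) mpoly" where
  "Var x = Poly_Mapping.single (Poly_Mapping.single x 1) 1"

text \<open>The polynomial ring in the indeterminates \<open>I\<close>, as a subset of the type.\<close>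

definition polys_in :: "'x set \<Rightarrow> ('x, 'k::zero) mpoly set" where
  "polys_in I = {p. \<forall>m\<in>Poly_Mapping.keys p. Poly_Mapping.keys m \<subseteq> I}"

text \<open>The \<open>'k\<close>-algebra homomorphism which maps each indeterminate \<open>x\<close> to \<open>u x\<close>.\<close>

definition subst_hom ::
    "('x \<Rightarrow> ('y, 'k::comm_ring_1) mpoly) \<Rightarrow> ('x, 'k) mpoly \<Rightarrow> ('y, 'k) mpoly" where
  "subst_hom u p = (\<Sum>m\<in>Poly_Mapping.keys p. Const (Poly_Mapping.lookup p m) *
      (\<Prod>x\<in>Poly_Mapping.keys m. u x ^ Poly_Mapping.lookup m x))"


definition subst_monom :: "('x \<Rightarrow> 'r::comm_ring_1) \<Rightarrow> ('x \<Rightarrow>\<^sub>0 nat) \<Rightarrow> 'r" where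
  "subst_monom u m = (\<Prod>x\<in>Poly_Mapping.keys m. u x ^ Poly_Mapping.lookup m x)"

lemma subst_monom_superset:
  assumes "finite A" "Poly_Mapping.keys m \<subseteq> A"
  shows "subst_monom u m = (\<Prod>x\<in>A. u x ^ Poly_Mapping.lookup m x)"
  unfolding subst_monom_def using assms
  by (intro prod.mono_neutral_left) (auto simp: in_keys_iff)

lemma subst_monom_add: "subst_monom u (m + n) = subst_monom u m * subst_monom u n"
proof -
  let ?A = "Poly_Mapping.keys m \<union> Poly_Mapping.keys n"
  have "subst_monom u (m + n) = (\<Prod>x\<in>?A. u x ^ Poly_Mapping.lookup (m + n) x)"
    by (rule subst_monom_superset) (auto simp: keys_add)
  also have "\<dots> = (\<Prod>x\<in>?A. u x ^ Poly_Mapping.lookup m x) * (\<Prod>x\<in>?A. u x ^ Poly_Mapping.lookup n x)"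
    by (simp add: lookup_add power_add prod.distrib)
  also have "\<dots> = subst_monom u m * subst_monom u n"
    by (subst (1 2) subst_monom_superset[where A = ?A]) auto
  finally show ?thesis .
qed

lemma Const_simps [simp]:
  "Const 0 = 0" "Const 1 = 1"
  "Const (a + b) = Const a + Const b"
  "Const (a * b) = Const a * (Const b :: ('x, 'k::comm_ring_1) mpoly)"
  by (simp_all add: Const_def single_add mult_single)

lemma subst_hom_superset:
  assumes "finite A" "Poly_Mapping.keys p \<subseteq> A"
  shows "subst_hom u p = (\<Sum>m\<in>A. Const (Poly_Mapping.lookup p m) * subst_monom u m)"
  unfolding subst_hom_def subst_monom_def using assms
  by (intro sum.mono_neutral_left) (auto simp: in_keys_iff)

lemma subst_hom_add: "subst_hom u (p + q) = subst_hom u p + subst_hom u q"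
proof -
  let ?A = "Poly_Mapping.keys p \<union> Poly_Mapping.keys q"
  have "subst_hom u (p + q) = (\<Sum>m\<in>?A. Const (Poly_Mapping.lookup (p + q) m) * subst_monom u m)"
    by (rule subst_hom_superset) (auto simp: keys_add)
  also have "\<dots> = (\<Sum>m\<in>?A. Const (Poly_Mapping.lookup p m) * subst_monom u m)
      + (\<Sum>m\<in>?A. Const (Poly_Mapping.lookup q m) * subst_monom u m)"
    by (simp add: lookup_add distrib_right sum.distrib)
  also have "\<dots> = subst_hom u p + subst_hom u q"
    by (subst (1 2) subst_hom_superset[where A = ?A]) auto
  finally show ?thesis .
qed

lemma subst_hom_0: "subst_hom u 0 = 0"
  by (simp add: subst_hom_def)

lemma subst_hom_sum: "subst_hom u (sum f A) = (\<Sum>a\<in>A. subst_hom u (f a))"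
  by (induction A rule: infinite_finite_induct) (simp_all add: subst_hom_0 subst_hom_add)

lemma subst_hom_single:
  "subst_hom u (Poly_Mapping.single m c) = Const c * subst_monom u m"
  by (subst subst_hom_superset[where A = "{m}"]) auto

lemma mpoly_sum_single:
  "(\<Sum>m\<in>Poly_Mapping.keys p. Poly_Mapping.single m (Poly_Mapping.lookup p m)) = p"
  by (rule poly_mapping_eqI) (auto simp: lookup_sum lookup_single when_def in_keys_iff)

lemma subst_hom_mult: "subst_hom u (p * q) = subst_hom u p * subst_hom u q"
proof -
  let ?s = "\<lambda>p m. Poly_Mapping.single m (Poly_Mapping.lookup p m)"
  let ?K = "\<lambda>p. Poly_Mapping.keys p"
  have "subst_hom u ((\<Sum>m\<in>?K p. ?s p m) * (\<Sum>n\<in>?K q. ?s q n))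
      = (\<Sum>m\<in>?K p. \<Sum>n\<in>?K q. subst_hom u (?s p m) * subst_hom u (?s q n))"
    by (simp add: sum_product subst_hom_sum mult_single subst_hom_single subst_monom_add
        mult_ac)
  also have "\<dots> = subst_hom u (\<Sum>m\<in>?K p. ?s p m) * subst_hom u (\<Sum>n\<in>?K q. ?s q n)"
    by (simp add: sum_product subst_hom_sum)
  finally show ?thesis by (simp only: mpoly_sum_single)
qed

lemma subst_hom_Const: "subst_hom u (Const c) = Const c"
  unfolding Const_def by (subst subst_hom_single) (simp add: subst_monom_def Const_def)

lemma subst_hom_Var: "subst_hom u (Var x) = u x"
  unfolding Var_def by (subst subst_hom_single) (simp add: subst_monom_def)


section \<open>The toric ring of the cut ideal\<close>

text \<open>The unordered partition \<open>A|B\<close> is encoded as the set \<open>{A, B}\<close>.\<close>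

definition cut_partitions :: "'v ugraph \<Rightarrow> 'v set set set" where
  "cut_partitions G = {{A, B} | A B. A \<inter> B = {} \<and> A \<union> B = verts G}"

text \<open>The condition \<open>|A \<inter> {i, j}| = 1\<close> does not depend on the choice of the block \<open>A\<close>,
  since it is equivalent to \<open>|B \<inter> {i, j}| = 1\<close>.\<close>

definition cut_edges :: "'v ugraph \<Rightarrow> 'v set set \<Rightarrow> 'v set set" where
  "cut_edges G P = {e \<in> edges G. \<exists>A\<in>P. card (A \<inter> e) = 1}"

datatype 'v cut_var = S | T "'v set"

definition cut_monomial :: "'v ugraph \<Rightarrow> 'v set set \<Rightarrow> ('v cut_var, 'k::comm_ring_1) mpoly" where
  "cut_monomial G P = Var S * (\<Prod>e\<in>cut_edges G P. Var (T e))"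

definition cut_hom ::
    "'v ugraph \<Rightarrow> ('v set set, 'k::comm_ring_1) mpoly \<Rightarrow> ('v cut_var, 'k) mpoly" where
  "cut_hom G = subst_hom (cut_monomial G)"

definition toric_ring :: "'v ugraph \<Rightarrow> ('v cut_var, 'k::comm_ring_1) mpoly ring" where
  "toric_ring G = ring_of_type_algebra\<lparr>carrier := cut_hom G ` polys_in (cut_partitions G)\<rparr>"

lemma polys_in_mult:
  assumes "p \<in> polys_in I" "q \<in> polys_in I"
  shows "p * q \<in> polys_in I"
  unfolding polys_in_def
proof (intro CollectI ballI)
  fix m assume "m \<in> Poly_Mapping.keys (p * q)"
  then obtain a b where "m = a + b" "a \<in> Poly_Mapping.keys p" "b \<in> Poly_Mapping.keys q"
    using keys_mult[of p q] by blast
  then show "Poly_Mapping.keys m \<subseteq> I"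
    using assms keys_add[of a b] unfolding polys_in_def by blast
qed

lemma polys_in_add:
  assumes "p \<in> polys_in I" "q \<in> polys_in I"
  shows "p + q \<in> polys_in I"
  using assms keys_add[of p q] unfolding polys_in_def by blast

lemma polys_in_Const: "Const c \<in> polys_in I"
  by (simp add: polys_in_def Const_def)

lemma toric_ring_cring: "cring (toric_ring G :: ('v cut_var, 'k::comm_ring_1) mpoly ring)"
proof -
  let ?R = "ring_of_type_algebra :: ('v cut_var, 'k) mpoly ring"
  let ?H = "cut_hom G ` polys_in (cut_partitions G) :: ('v cut_var, 'k) mpoly set"
  interpret R: cring ?R by (rule cring_from_type_algebra)
  have c: "Const c \<in> ?H" for c
    by (rule image_eqI[OF _ polys_in_Const]) (simp add: cut_hom_def subst_hom_Const)
  have m: "x * y \<in> ?H" if xy: "x \<in> ?H" "y \<in> ?H" for x y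
  proof -
    obtain p q where "x = cut_hom G p" "y = cut_hom G q"
      "p \<in> polys_in (cut_partitions G)" "q \<in> polys_in (cut_partitions G)"
      using xy by blast
    then show ?thesis
      by (intro image_eqI[of _ _ "p * q"]) (simp_all add: cut_hom_def subst_hom_mult polys_in_mult)
  qed
  have a: "x + y \<in> ?H" if xy: "x \<in> ?H" "y \<in> ?H" for x y
  proof -
    obtain p q where "x = cut_hom G p" "y = cut_hom G q"
      "p \<in> polys_in (cut_partitions G)" "q \<in> polys_in (cut_partitions G)"
      using xy by blast
    then show ?thesis
      by (intro image_eqI[of _ _ "p + q"]) (simp_all add: cut_hom_def subst_hom_add polys_in_add)
  qed
  have inv: "\<ominus>\<^bsub>?R\<^esub> x = Const (-1) * x" for x
  proof (rule R.minus_equality)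
    have "Const (-1) * x + x = Const (-1 + 1) * x"
      unfolding Const_simps by (simp add: distrib_right)
    then show "Const (-1) * x \<oplus>\<^bsub>?R\<^esub> x = \<zero>\<^bsub>?R\<^esub>"
      by (simp add: ring_of_type_algebra_def)
  qed (simp_all add: ring_of_type_algebra_def)
  have "subring ?H ?R"
  proof (rule R.subringI)
    show "\<one>\<^bsub>?R\<^esub> \<in> ?H" using c[of 1] by (simp add: ring_of_type_algebra_def)
    show "\<ominus>\<^bsub>?R\<^esub> h \<in> ?H" if "h \<in> ?H" for h
      unfolding inv using m[OF c that] .
  qed (use m a in \<open>auto simp: ring_of_type_algebra_def\<close>)
  then have "subcring ?H ?R"
    by (rule R.subcringI')
  then show ?thesis
    unfolding toric_ring_def by (subst (asm) R.subcring_iff) (simp_all add: ring_of_type_algebra_def)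
qed

definition toric_gens :: "'v ugraph \<Rightarrow> ('v cut_var, 'k::comm_ring_1) mpoly set" where
  "toric_gens G = cut_monomial G ` cut_partitions G"

definition toric_component :: "'v ugraph \<Rightarrow> nat \<Rightarrow> ('v cut_var, 'k::comm_ring_1) mpoly set" where
  "toric_component G d =
     {f \<in> carrier (toric_ring G). \<forall>m\<in>Poly_Mapping.keys f. Poly_Mapping.lookup m S = d}"


section \<open>Strong Koszulness\<close>

text \<open>\<open>R\<close> is the ring, \<open>C d\<close> its homogeneous component of degree \<open>d\<close>, and \<open>U\<close> the set of its
  monomial generators of degree 1.\<close>

definition strongly_koszul :: "('a, 'b) ring_scheme \<Rightarrow> (nat \<Rightarrow> 'a set) \<Rightarrow> 'a set \<Rightarrow> bool" where
  "strongly_koszul R C U \<longleftrightarrow>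
     (\<forall>u\<in>U. \<forall>v\<in>U. u \<noteq> v \<longrightarrow> (\<exists>B \<subseteq> C 2. PIdl\<^bsub>R\<^esub> u \<inter> PIdl\<^bsub>R\<^esub> v = Idl\<^bsub>R\<^esub> B))"

end

theory Submission
  imports Defs
begin

text \<open>
  All rings and ideals involved are spanned by monomials, so strong Koszulness of \<open>R\<^sub>G\<close> is a statement
  about sums of cut vectors.  Switching reduces it to the following: if a vector is a sum of
  \<open>d + 1\<close> cuts and remains one when the cut \<open>A\<close> is subtracted, then it has a decomposition into
  \<open>d + 1\<close> cuts one of which contains \<open>A\<close>.  This property passes to edge sets glued at a vertex.
  An edge set which is not glued from smaller ones and has neither a cycle of length at least \<open>5\<close> nor a \<open>K\<^sub>4\<close>
  is \<open>K\<^bsub>2,n\<^esub>\<close> or \<open>K\<^bsub>1,1,n\<^esub>\<close> (extend a maximal such subgraph by an ear), where the sums of \<open>d\<close> cuts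
  are given by explicit inequalities and a parity condition.

  Conversely, the property passes to contractions of \<open>G\<close>, so \<open>G\<close> may be replaced by \<open>K\<^sub>4\<close> or by a
  pentagon with chords in at most one vertex.  It fails for \<open>K\<^sub>4\<close> since the three splits into two pairs
  and the four splits with a singleton have the same sum, and for the pentagon \<open>0, 1, 2, 3, 4\<close> with
  chords only at \<open>0\<close> because of \<open>{2, 4} + {1, 3} = {1, 4} + {2} + {3}\<close>.
\<close>
section \<open>Sums of cuts\<close>

text \<open>Why one cut containing \<open>A\<close> is enough: after switching, the two generators
  are the empty cut and \<open>A\<close>. If a cut \<open>Z\<close> contains \<open>A\<close>, then
  \<open>Z - A\<close> is the cut of the symmetric difference of \<open>Z\<close> and
  \<open>A\<close>, so "empty cut plus \<open>Z\<close>" equals "\<open>A\<close> plus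
  \<open>Z - A\<close>" and is an element of degree 2 in both ideals. A monomial in both ideals has
  degree \<open>d + 2\<close>; splitting off either generator leaves \<open>d + 1\<close> cuts,
  which is the \<open>Suc d\<close> in both hypotheses of \<open>koszul_cuts\<close>.

  The converse has to treat contraction and deletion differently. Contraction passes to a face: cuts
  are nonnegative, so if a sum vanishes on the contracted edges, every summand does. Deletion only
  forgets a coordinate, and an identity between sums of cuts may fail on the forgotten edge. Hence
  extra edges of the contracted graph cannot be dropped, and the identity for the pentagon is chosen
  so that it survives chords at one vertex.\<close>

definition cut_ind :: "'v set \<Rightarrow> 'v set \<Rightarrow> int" where
  "cut_ind A e = of_bool (card (A \<inter> e) = 1)"

text \<open>Summands are arbitrary sets and agreement is required on \<open>E\<close> only, so
  complements, restriction to subsets of \<open>E\<close> and gluing need no bookkeeping about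
  vertices.\<close>

definition cut_sum :: "'v set set \<Rightarrow> nat \<Rightarrow> ('v set \<Rightarrow> int) \<Rightarrow> bool" where
  "cut_sum E d w \<longleftrightarrow> (\<exists>f. \<forall>e\<in>E. w e = (\<Sum>k<d. cut_ind (f k) e))"

definition koszul_cuts :: "'v set set \<Rightarrow> bool" where
  "koszul_cuts E \<longleftrightarrow> (\<forall>d w A. cut_sum E (Suc d) w \<longrightarrow> cut_sum E (Suc d) (\<lambda>e. w e - cut_ind A e) \<longrightarrow>
     (\<exists>Z. (\<forall>e\<in>E. cut_ind A e \<le> cut_ind Z e) \<and> cut_sum E d (\<lambda>e. w e - cut_ind Z e)))"

lemma cut_ind_pair: "x \<noteq> y \<Longrightarrow> cut_ind A {x, y} = of_bool ((x \<in> A) \<noteq> (y \<in> A))"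
  by (cases "x \<in> A"; cases "y \<in> A") (auto simp: cut_ind_def)

lemma cut_ind_empty [simp]: "cut_ind {} e = 0"
  by (simp add: cut_ind_def)

lemma cut_ind_cases: "cut_ind A e = 0 \<or> cut_ind A e = 1"
  by (simp add: cut_ind_def)

lemma cut_ind_nonneg: "0 \<le> cut_ind A e"
  by (simp add: cut_ind_def)

lemma cut_ind_Compl: "card e = 2 \<Longrightarrow> cut_ind (- A) e = cut_ind A e"
  by (auto simp: card_2_iff cut_ind_pair)

lemma cut_ind_symdiff:
  "card e = 2 \<Longrightarrow> cut_ind (sym_diff A B) e = \<bar>cut_ind A e - cut_ind B e\<bar>"
  by (auto simp: card_2_iff cut_ind_pair)

lemma cut_sum_cong: "(\<And>e. e \<in> E \<Longrightarrow> w e = w' e) \<Longrightarrow> cut_sum E d w \<longleftrightarrow> cut_sum E d w'"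
  by (simp add: cut_sum_def)

lemma cut_sum_mono: "cut_sum E d w \<Longrightarrow> F \<subseteq> E \<Longrightarrow> cut_sum F d w"
  unfolding cut_sum_def by blast

lemma cut_sum_0 [simp]: "cut_sum E 0 w \<longleftrightarrow> (\<forall>e\<in>E. w e = 0)"
  by (simp add: cut_sum_def)

lemma cut_sum_Suc: "cut_sum E (Suc d) w \<longleftrightarrow> (\<exists>A. cut_sum E d (\<lambda>e. w e - cut_ind A e))"
proof
  assume "cut_sum E (Suc d) w"
  then obtain f where "\<forall>e\<in>E. w e = (\<Sum>k<Suc d. cut_ind (f k) e)"
    unfolding cut_sum_def by blast
  then have "\<forall>e\<in>E. w e - cut_ind (f d) e = (\<Sum>k<d. cut_ind (f k) e)" by simp
  then show "\<exists>A. cut_sum E d (\<lambda>e. w e - cut_ind A e)" unfolding cut_sum_def by blast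
next
  assume "\<exists>A. cut_sum E d (\<lambda>e. w e - cut_ind A e)"
  then obtain A f where f: "\<forall>e\<in>E. w e - cut_ind A e = (\<Sum>k<d. cut_ind (f k) e)"
    unfolding cut_sum_def by blast
  have "(\<Sum>k<Suc d. cut_ind ((f(d := A)) k) e) = (\<Sum>k<d. cut_ind (f k) e) + cut_ind A e" for e
    by simp
  with f have "\<forall>e\<in>E. w e = (\<Sum>k<Suc d. cut_ind ((f(d := A)) k) e)" by (metis diff_add_cancel)
  then show "cut_sum E (Suc d) w" unfolding cut_sum_def by blast
qed

text \<open>On a single triangle with edge values \<open>m\<close>, \<open>x\<close>, \<open>y\<close> the sums of \<open>d\<close> cut vectors are
  the points of the metric polytope, scaled by \<open>d\<close>, with even perimeter.\<close>

definition cut_triangle :: "nat \<Rightarrow> int \<Rightarrow> int \<Rightarrow> int \<Rightarrow> bool" where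
  "cut_triangle d m x y \<longleftrightarrow> (\<exists>k. x + y + m = 2 * k \<and> m \<le> k \<and> x \<le> k \<and> y \<le> k \<and> k \<le> int d)"

lemma cut_triangleI:
  "x + y + m = 2 * k \<Longrightarrow> m \<le> k \<Longrightarrow> x \<le> k \<Longrightarrow> y \<le> k \<Longrightarrow> k \<le> int d \<Longrightarrow> cut_triangle d m x y"
  unfolding cut_triangle_def by blast

lemma cut_triangleE:
  assumes "cut_triangle d m x y"
  obtains k where "x + y + m = 2 * k" "m \<le> k" "x \<le> k" "y \<le> k" "k \<le> int d"
  using assms unfolding cut_triangle_def by blast

section \<open>Triangles on a common edge: the graphs \<open>K_{1,1,n}\<close>\<close>

definition bip :: "'v \<Rightarrow> 'v \<Rightarrow> 'v set \<Rightarrow> 'v set set" where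
  "bip a b C = (\<lambda>c. {a, c}) ` C \<union> (\<lambda>c. {b, c}) ` C"

lemma bip_ball: "(\<forall>e\<in>bip a b C. P e) \<longleftrightarrow> (\<forall>c\<in>C. P {a, c} \<and> P {b, c})"
  unfolding bip_def by blast

lemma bip_commute: "bip a b C = bip b a C"
  unfolding bip_def by blast

text \<open>By parity \<open>x + y\<close> is either \<open>m\<close> or at least
  \<open>m + 2\<close>. In the first case the half perimeter is \<open>m\<close>, which is already
  at most \<open>d\<close>. In the second case lowering both edges lowers the half perimeter by one
  and keeps it above \<open>m\<close>.\<close>

lemma cut_triangle_shrink:
  assumes "cut_triangle (Suc d) m x y" "m \<le> int d"
  shows "cut_triangle d m (x - of_bool (x + y \<ge> m + 2)) (y - of_bool (x + y \<ge> m + 2))"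
proof -
  obtain k where "x + y + m = 2 * k" "m \<le> k" "x \<le> k" "y \<le> k" "k \<le> int (Suc d)"
    using assms by (elim cut_triangleE)
  then show ?thesis using assms(2)
    by (cases "x + y \<ge> m + 2") (auto intro: cut_triangleI[of _ _ _ k] cut_triangleI[of _ _ _ "k - 1"])
qed

text \<open>With \<open>m\<close> at its maximum the half perimeter is squeezed to
  \<open>d + 1\<close>, so \<open>x + y = d + 1\<close> and exactly one of the two edges must drop.
  The test \<open>y + 1 <= x + d\<close> then just says \<open>x >= 1\<close>; otherwise
  \<open>x = 0\<close>, and \<open>y\<close> drops.\<close>

lemma cut_triangle_shrink_apex:
  assumes "cut_triangle (Suc d) (1 + int d) x y"
  shows "cut_triangle d (int d) (x - of_bool (y + 1 \<le> x + int d)) (y - of_bool (\<not> y + 1 \<le> x + int d))"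
proof -
  obtain k where "x + y + (1 + int d) = 2 * k" "1 + int d \<le> k" "x \<le> k" "y \<le> k" "k \<le> int (Suc d)"
    using assms by (elim cut_triangleE)
  then show ?thesis
    by (cases "y + 1 \<le> x + int d") (auto intro: cut_triangleI[of _ _ _ "k - 1"])
qed

text \<open>\<open>p\<close>, \<open>q\<close>, \<open>r\<close> record the sides of the three
  corners. A cut meets a triangle in no edge or in two, so adding it raises the half perimeter by at
  most one and keeps the perimeter even.\<close>

lemma cut_triangle_grow:
  fixes p q r :: bool
  assumes "cut_triangle d (m - of_bool (p \<noteq> q)) (x - of_bool (p \<noteq> r)) (y - of_bool (q \<noteq> r))"
  shows "cut_triangle (Suc d) m x y"
proof -
  obtain k where "x - of_bool (p \<noteq> r) + (y - of_bool (q \<noteq> r)) + (m - of_bool (p \<noteq> q)) = 2 * k"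
    "m - of_bool (p \<noteq> q) \<le> k" "x - of_bool (p \<noteq> r) \<le> k" "y - of_bool (q \<noteq> r) \<le> k" "k \<le> int d"
    using assms by (elim cut_triangleE)
  then show ?thesis
    by (cases p; cases q; cases r) (auto intro: cut_triangleI[of _ _ _ k] cut_triangleI[of _ _ _ "k + 1"])
qed

text \<open>Elimination of the common value \<open>m\<close>: one triangle gives
  \<open>|x - y| <= m\<close>, the other gives \<open>m <= min (x' + y') (2 * d - x' - y')\<close>,
  which is \<open>d - |x' + y' - d|\<close>.\<close>

lemma cut_triangle_pair:
  assumes "cut_triangle d m x y" "cut_triangle d m x' y'"
  shows "even (x + y + x' + y')" "\<bar>x - y\<bar> + \<bar>x' + y' - int d\<bar> \<le> int d"
proof -
  obtain k k' where "x + y + m = 2 * k" "m \<le> k" "x \<le> k" "y \<le> k" "k \<le> int d"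
    "x' + y' + m = 2 * k'" "m \<le> k'" "x' \<le> k'" "y' \<le> k'" "k' \<le> int d"
    using assms by (elim cut_triangleE)
  note * = this
  have "x + y + x' + y' = 2 * (k + k' - m)" using * by simp
  then show "even (x + y + x' + y')" by (metis dvd_triv_left)
  show "\<bar>x - y\<bar> + \<bar>x' + y' - int d\<bar> \<le> int d" using * by linarith
qed

text \<open>The way back from the elimination: a difference \<open>|x' - y'|\<close> that dominates
  \<open>|x - y|\<close> can serve as \<open>m\<close>. Its parity is right because
  \<open>x' - y'\<close> and \<open>x' + y'\<close> have the same parity.\<close>

lemma cut_triangle_absI:
  assumes "even (x' + y' + x + y)" "\<bar>x' - y'\<bar> + \<bar>x + y - int d\<bar> \<le> int d" "\<bar>x - y\<bar> \<le> \<bar>x' - y'\<bar>"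
  shows "cut_triangle d \<bar>x' - y'\<bar> x y"
proof -
  obtain k where k: "x' + y' + x + y = 2 * k" using assms(1) by (elim evenE)
  show ?thesis using assms(2,3) k
    by (intro cut_triangleI[of _ _ _ "if x' \<ge> y' then k - y' else k - x'"]) auto
qed

text \<open>Once the value on \<open>{a, b}\<close> is fixed, the triangles are independent: each
  \<open>c\<close> can be put on either side without regard to the others. So one cut is peeled off
  by choosing sides vertex by vertex.\<close>

lemma cut_sum_triangles:
  assumes ab: "a \<noteq> b" "a \<notin> C" "b \<notin> C"
  shows "cut_sum (insert {a, b} (bip a b C)) d w \<longleftrightarrow>
    0 \<le> w {a, b} \<and> w {a, b} \<le> int d \<and> (\<forall>c\<in>C. cut_triangle d (w {a, b}) (w {a, c}) (w {b, c}))"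
proof (induction d arbitrary: w)
  case 0
  show ?case by (auto simp: bip_ball cut_triangle_def)
next
  case (Suc d)
  have ne: "a \<noteq> c" "b \<noteq> c" if "c \<in> C" for c using ab that by auto
  have ins: "(\<exists>A. cut_sum (insert {a, b} (bip a b C)) d (\<lambda>e. w e - cut_ind A e)) \<longleftrightarrow>
    0 \<le> w {a, b} \<and> w {a, b} \<le> int (Suc d) \<and> (\<forall>c\<in>C. cut_triangle (Suc d) (w {a, b}) (w {a, c}) (w {b, c}))"
    (is "?L \<longleftrightarrow> ?R")
  proof
    assume ?L
    then obtain A where A: "0 \<le> w {a, b} - cut_ind A {a, b}" "w {a, b} - cut_ind A {a, b} \<le> int d"
      "\<And>c. c \<in> C \<Longrightarrow> cut_triangle d (w {a, b} - cut_ind A {a, b}) (w {a, c} - cut_ind A {a, c}) (w {b, c} - cut_ind A {b, c})"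
      unfolding Suc.IH by blast
    have "cut_triangle (Suc d) (w {a, b}) (w {a, c}) (w {b, c})" if c: "c \<in> C" for c
      using A(3)[OF c] ab ne[OF c] by (intro cut_triangle_grow[of d _ "a \<in> A" "b \<in> A" _ "c \<in> A"]) (simp add: cut_ind_pair)
    with A(1,2) cut_ind_cases[of A "{a, b}"] show ?R by auto
  next
    assume R: ?R
    show ?L
    proof (cases "w {a, b} \<le> int d")
      case True
      \<comment> \<open>\<open>a\<close> and \<open>b\<close> stay on the same side; exactly the
        vertices with room in the inequality \<open>m <= x + y\<close> are moved to the other
        side.\<close>
      let ?A = "{c \<in> C. w {a, c} + w {b, c} \<ge> w {a, b} + 2}"
      have "cut_sum (insert {a, b} (bip a b C)) d (\<lambda>e. w e - cut_ind ?A e)"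
        unfolding Suc.IH using R True ab ne cut_triangle_shrink[OF _ True]
        by (simp add: cut_ind_pair)
      then show ?L ..
    next
      case False
      then have m: "w {a, b} = int (Suc d)" using R by simp
      \<comment> \<open>The value on \<open>{a, b}\<close> is \<open>d + 1\<close>, so every summand
        separates \<open>a\<close> from \<open>b\<close>; each \<open>c\<close> joins the side that
        lowers a positive edge.\<close>
      let ?A = "insert b {c \<in> C. w {b, c} + 1 \<le> w {a, c} + int d}"
      have "cut_sum (insert {a, b} (bip a b C)) d (\<lambda>e. w e - cut_ind ?A e)"
        unfolding Suc.IH
      proof (intro conjI ballI)
        fix c assume c: "c \<in> C"
        have "cut_triangle (Suc d) (1 + int d) (w {a, c}) (w {b, c})" using R c m by simp
        note * = cut_triangle_shrink_apex[OF this]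
        show "cut_triangle d (w {a, b} - cut_ind ?A {a, b}) (w {a, c} - cut_ind ?A {a, c}) (w {b, c} - cut_ind ?A {b, c})"
          using * c ab ne[OF c] by (cases "w {b, c} + 1 \<le> w {a, c} + int d") (simp_all add: cut_ind_pair m)
      qed (use ab in \<open>simp_all add: cut_ind_pair m\<close>)
      then show ?L ..
    qed
  qed
  then show ?case unfolding cut_sum_Suc .
qed

lemma cut_ind_avoiding:
  assumes "\<And>e. e \<in> E \<Longrightarrow> card e = 2"
  obtains A' where "(v \<in> A') \<longleftrightarrow> Q" "\<And>e. e \<in> E \<Longrightarrow> cut_ind A' e = cut_ind A e"
proof (cases "(v \<in> A) \<longleftrightarrow> Q")
  case True then show ?thesis using that[of A] by blast
next
  case False then show ?thesis using that[of "- A"] assms cut_ind_Compl by (metis ComplI Compl_iff)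
qed

text \<open>Two normalisations. Complementing \<open>A\<close> moves \<open>v\<close> out of it
  without changing the cut. A cut that meets no edge of \<open>E\<close> is contained in every cut,
  so any summand of \<open>w\<close> serves as \<open>Z\<close>.\<close>

lemma koszul_cutsI:
  assumes E: "\<And>e. e \<in> E \<Longrightarrow> card e = 2"
    and *: "\<And>d w A c. cut_sum E (Suc d) w \<Longrightarrow> cut_sum E (Suc d) (\<lambda>e. w e - cut_ind A e) \<Longrightarrow> v \<notin> A \<Longrightarrow>
      c \<in> E \<Longrightarrow> cut_ind A c \<noteq> 0 \<Longrightarrow>
      \<exists>Z. (\<forall>e\<in>E. cut_ind A e \<le> cut_ind Z e) \<and> cut_sum E d (\<lambda>e. w e - cut_ind Z e)"
  shows "koszul_cuts E"
  unfolding koszul_cuts_def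
proof (intro allI impI)
  fix d w A assume w: "cut_sum E (Suc d) w" "cut_sum E (Suc d) (\<lambda>e. w e - cut_ind A e)"
  obtain A' where A': "v \<notin> A'" "\<And>e. e \<in> E \<Longrightarrow> cut_ind A' e = cut_ind A e"
    using cut_ind_avoiding[of E v False A] E by auto
  show "\<exists>Z. (\<forall>e\<in>E. cut_ind A e \<le> cut_ind Z e) \<and> cut_sum E d (\<lambda>e. w e - cut_ind Z e)"
  proof (cases "\<exists>c\<in>E. cut_ind A' c \<noteq> 0")
    case True
    have "cut_sum E (Suc d) (\<lambda>e. w e - cut_ind A' e)"
      using w(2) A'(2) by (simp cong: cut_sum_cong)
    moreover from True obtain c where "c \<in> E" "cut_ind A' c \<noteq> 0" by blast
    ultimately obtain Z where "\<forall>e\<in>E. cut_ind A' e \<le> cut_ind Z e" "cut_sum E d (\<lambda>e. w e - cut_ind Z e)"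
      using *[OF w(1) _ A'(1)] by blast
    with A'(2) show ?thesis by auto
  next
    case False
    obtain Z where "cut_sum E d (\<lambda>e. w e - cut_ind Z e)" using w(1) unfolding cut_sum_Suc by blast
    moreover have "cut_ind A e \<le> cut_ind Z e" if "e \<in> E" for e
      using False A'(2)[OF that] that cut_ind_nonneg[of Z e] by auto
    ultimately show ?thesis by blast
  qed
qed

lemma card_bip: "a \<notin> C \<Longrightarrow> b \<notin> C \<Longrightarrow> e \<in> bip a b C \<Longrightarrow> card e = 2"
  unfolding bip_def by (auto simp: card_2_iff)

text \<open>If \<open>A\<close> separates \<open>a\<close> from \<open>b\<close>, it meets each
  triangle in two edges, so the half perimeters drop to at most \<open>d\<close> and
  \<open>A\<close> itself is the summand. Otherwise \<open>A\<close> must be enlarged.\<close>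

lemma koszul_cuts_triangles:
  assumes ab: "a \<noteq> b" "a \<notin> C" "b \<notin> C"
  shows "koszul_cuts (insert {a, b} (bip a b C))"
proof (rule koszul_cutsI[where v = a])
  show "card e = 2" if "e \<in> insert {a, b} (bip a b C)" for e
    using that ab card_bip[of a C b] by auto
next
  fix d w A c0
  let ?E = "insert {a, b} (bip a b C)"
  have ne: "a \<noteq> c" "b \<noteq> c" if "c \<in> C" for c using ab that by auto
  assume w: "cut_sum ?E (Suc d) w" "cut_sum ?E (Suc d) (\<lambda>e. w e - cut_ind A e)"
    and aA: "a \<notin> A" and c0: "c0 \<in> ?E" "cut_ind A c0 \<noteq> 0"
  note w' = w[unfolded cut_sum_triangles[OF ab]]
  show "\<exists>Z. (\<forall>e\<in>?E. cut_ind A e \<le> cut_ind Z e) \<and> cut_sum ?E d (\<lambda>e. w e - cut_ind Z e)"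
  proof (cases "b \<in> A")
    case True
    have "cut_triangle d (w {a, b} - 1) (w {a, c} - cut_ind A {a, c}) (w {b, c} - cut_ind A {b, c})"
      if c: "c \<in> C" for c
    proof -
      have 1: "cut_triangle (Suc d) (w {a, b}) (w {a, c}) (w {b, c})"
        "cut_triangle (Suc d) (w {a, b} - 1) (w {a, c} - cut_ind A {a, c}) (w {b, c} - cut_ind A {b, c})"
        using w' c ab aA True by (auto simp: cut_ind_pair)
      have 2: "cut_ind A {a, c} + cut_ind A {b, c} = 1" using aA True c ne[OF c] by (simp add: cut_ind_pair)
      from 1 obtain k k' where "w {a, c} + w {b, c} + w {a, b} = 2 * k" "k \<le> int (Suc d)"
        "w {a, c} - cut_ind A {a, c} + (w {b, c} - cut_ind A {b, c}) + (w {a, b} - 1) = 2 * k'"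
        "w {a, b} - 1 \<le> k'" "w {a, c} - cut_ind A {a, c} \<le> k'" "w {b, c} - cut_ind A {b, c} \<le> k'"
        by (elim cut_triangleE)
      with 2 show ?thesis by (intro cut_triangleI[of _ _ _ k']) auto
    qed
    then have "cut_sum ?E d (\<lambda>e. w e - cut_ind A e)"
      unfolding cut_sum_triangles[OF ab] using w' ab aA True by (simp add: cut_ind_pair)
    then show ?thesis by blast
  next
    case False
    \<comment> \<open>A triangle with half perimeter \<open>d + 1\<close> violates the bound for
      \<open>d\<close> unless its apex is cut off, so all such apexes join \<open>A\<close>.\<close>
    let ?Z = "{c \<in> C. c \<in> A \<or> w {a, c} + w {b, c} + w {a, b} = 2 * int (Suc d)}"
    obtain c1 where c1: "c1 \<in> C" "c1 \<in> A"
      using c0 aA False ab ne by (auto simp: bip_def cut_ind_pair split: if_splits)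
    have tr: "cut_triangle (Suc d) (w {a, b}) (w {a, c}) (w {b, c})"
      "cut_triangle (Suc d) (w {a, b}) (w {a, c} - of_bool (c \<in> A)) (w {b, c} - of_bool (c \<in> A))"
      if "c \<in> C" for c
      using w' that ab aA False ne[OF that] by (auto simp: cut_ind_pair split del: if_split)
    \<comment> \<open>In the triangle at \<open>c1\<close> the half perimeter drops by one, from at
      most \<open>d + 1\<close>, and still bounds the edge \<open>{a, b}\<close>.\<close>
    have m: "w {a, b} \<le> int d"
      using tr[OF c1(1)] c1(2) by (auto elim!: cut_triangleE)
    have "cut_triangle d (w {a, b}) (w {a, c} - cut_ind ?Z {a, c}) (w {b, c} - cut_ind ?Z {b, c})"
      if c: "c \<in> C" for c
    proof -
      from tr[OF c] obtain k k' where k: "w {a, c} + w {b, c} + w {a, b} = 2 * k" "w {a, b} \<le> k"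
        "w {a, c} \<le> k" "w {b, c} \<le> k" "k \<le> int (Suc d)"
        "w {a, c} - of_bool (c \<in> A) + (w {b, c} - of_bool (c \<in> A)) + w {a, b} = 2 * k'" "w {a, b} \<le> k'"
        by (elim cut_triangleE)
      show ?thesis
      proof (cases "c \<in> ?Z")
        case True
        then have "cut_ind ?Z {a, c} = 1" "cut_ind ?Z {b, c} = 1" using c ab ne[OF c] by (simp_all add: cut_ind_pair)
        with True k m show ?thesis by (intro cut_triangleI[of _ _ _ "k - 1"]) (auto split: if_splits)
      next
        case False
        then have "cut_ind ?Z {a, c} = 0" "cut_ind ?Z {b, c} = 0" using c ab ne[OF c] by (simp_all add: cut_ind_pair)
        with False c k show ?thesis by (intro cut_triangleI[of _ _ _ k]) auto
      qed
    qed
    then have "cut_sum ?E d (\<lambda>e. w e - cut_ind ?Z e)"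
      unfolding cut_sum_triangles[OF ab] using m w'(1) ab by (simp add: cut_ind_pair)
    moreover have "\<forall>e\<in>?E. cut_ind A e \<le> cut_ind ?Z e"
      using ab aA False ne by (auto simp: bip_def cut_ind_pair)
    ultimately show ?thesis by blast
  qed
qed

section \<open>The graphs \<open>K_{2,n}\<close>\<close>

lemma cut_sum_bip:
  assumes ab: "a \<noteq> b" "a \<notin> C" "b \<notin> C" and C: "finite C" "C \<noteq> {}"
  shows "cut_sum (bip a b C) d w \<longleftrightarrow> (\<forall>i\<in>C. \<forall>j\<in>C. even (w {a, i} + w {b, i} + w {a, j} + w {b, j}) \<and>
     \<bar>w {a, i} - w {b, i}\<bar> + \<bar>w {a, j} + w {b, j} - int d\<bar> \<le> int d)" (is "?L \<longleftrightarrow> ?R")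
proof -
  have nab: "{a, b} \<notin> bip a b C" using ab by (auto simp: bip_def doubleton_eq_iff)
  \<comment> \<open>\<open>K_{2,n}\<close> is \<open>K_{1,1,n}\<close> without the edge
    \<open>{a, b}\<close>; the value \<open>m\<close> on that edge is guessed and then
    eliminated.\<close>
  have "?L \<longleftrightarrow> (\<exists>m. 0 \<le> m \<and> m \<le> int d \<and> (\<forall>c\<in>C. cut_triangle d m (w {a, c}) (w {b, c})))" (is "_ \<longleftrightarrow> ?M")
  proof
    assume ?L
    then obtain f where f: "\<forall>e\<in>bip a b C. w e = (\<Sum>k<d. cut_ind (f k) e)" unfolding cut_sum_def ..
    let ?w = "w({a, b} := (\<Sum>k<d. cut_ind (f k) {a, b}))"
    have "cut_sum (insert {a, b} (bip a b C)) d ?w"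
      unfolding cut_sum_def using f nab by (intro exI[of _ f]) auto
    moreover have "?w {a, c} = w {a, c}" "?w {b, c} = w {b, c}" if "c \<in> C" for c
      using ab that by (auto simp: doubleton_eq_iff)
    ultimately show ?M unfolding cut_sum_triangles[OF ab] by (metis fun_upd_same)
  next
    assume ?M
    then obtain m where m: "0 \<le> m \<and> m \<le> int d" "\<forall>c\<in>C. cut_triangle d m (w {a, c}) (w {b, c})" by blast
    let ?w = "w({a, b} := m)"
    have "?w {a, c} = w {a, c}" "?w {b, c} = w {b, c}" if "c \<in> C" for c
      using ab that by (auto simp: doubleton_eq_iff)
    then have "cut_sum (insert {a, b} (bip a b C)) d ?w"
      unfolding cut_sum_triangles[OF ab] using m by simp
    then have "cut_sum (bip a b C) d ?w" by (rule cut_sum_mono) blast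
    then show ?L using nab by (subst (asm) cut_sum_cong[where w' = w]) auto
  qed
  also have "\<dots> \<longleftrightarrow> ?R"
  proof
    assume ?M
    then obtain m where m: "\<forall>c\<in>C. cut_triangle d m (w {a, c}) (w {b, c})" by blast
    show ?R
    proof (intro ballI)
      fix i j assume "i \<in> C" "j \<in> C"
      with m have "cut_triangle d m (w {a, i}) (w {b, i})" "cut_triangle d m (w {a, j}) (w {b, j})" by auto
      then show "even (w {a, i} + w {b, i} + w {a, j} + w {b, j}) \<and>
        \<bar>w {a, i} - w {b, i}\<bar> + \<bar>w {a, j} + w {b, j} - int d\<bar> \<le> int d"
        by (intro conjI cut_triangle_pair)
    qed
  next
    assume R: ?R
    \<comment> \<open>The conditions ask for \<open>m\<close> between all \<open>|x - y|\<close> and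
      all \<open>d - |x + y - d|\<close>. The pairwise inequalities say that no lower bound exceeds
      an upper one, so the largest lower bound is a solution.\<close>
    define m where "m = Max ((\<lambda>i. \<bar>w {a, i} - w {b, i}\<bar>) ` C)"
    have "m \<in> (\<lambda>i. \<bar>w {a, i} - w {b, i}\<bar>) ` C" unfolding m_def using C by (intro Max_in) auto
    then obtain i where i: "i \<in> C" "m = \<bar>w {a, i} - w {b, i}\<bar>" by blast
    have mx: "\<bar>w {a, c} - w {b, c}\<bar> \<le> m" if "c \<in> C" for c
      unfolding m_def using C that by (intro Max_ge) auto
    have "cut_triangle d m (w {a, c}) (w {b, c})" if c: "c \<in> C" for c
      unfolding i(2) using bspec[OF bspec[OF R i(1)] c] mx[OF c] i(2) by (intro cut_triangle_absI) auto
    moreover have "0 \<le> m" "m \<le> int d" using bspec[OF bspec[OF R i(1)] i(1)] i(2) by auto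
    ultimately show ?M by blast
  qed
  finally show ?thesis .
qed


text \<open>In the application \<open>a\<close>, \<open>a'\<close> are differences
  \<open>x - y\<close>, and \<open>b\<close>, \<open>b'\<close> are sums \<open>x + y\<close>
  shifted by \<open>d\<close>. If subtracting \<open>A\<close> fails, parity makes it fail by 2,
  which leaves no slack: \<open>|a|\<close> grows by one and \<open>|a| + |b - 1| = d + 1\<close>.
  Then \<open>|a'| <= |a|\<close>, and \<open>w2\<close> leaves at most \<open>d - |a|\<close> for
  \<open>|b' - 2|\<close>. This is the condition for subtracting the cut that lowers both edges at
  every vertex of \<open>C\<close>.\<close>

lemma bip_exchange:
  fixes a b a' b' d :: int
  assumes s: "s = 1 \<or> s = -1"
    and par: "even (a + b + d)"
    and ab: "\<bar>a - s\<bar> + \<bar>b - 1\<bar> > d"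
    and w1: "\<bar>a\<bar> + \<bar>b - 1\<bar> \<le> d + 1" "\<bar>a'\<bar> + \<bar>b - 1\<bar> \<le> d + 1"
    and w2: "\<bar>a - s\<bar> + \<bar>b' - 2\<bar> \<le> d + 1"
  shows "\<bar>a'\<bar> + \<bar>b' - 2\<bar> \<le> d"
proof -
  have "even (\<bar>a - s\<bar> + \<bar>b - 1\<bar> + d)" using s par by auto
  with ab have "\<bar>a - s\<bar> + \<bar>b - 1\<bar> \<ge> d + 2" by presburger
  moreover have "\<bar>a - s\<bar> \<le> \<bar>a\<bar> + 1" using s by linarith
  ultimately have "\<bar>a - s\<bar> = \<bar>a\<bar> + 1" "\<bar>a\<bar> + \<bar>b - 1\<bar> = d + 1" using w1(1) by linarith+
  then show ?thesis using w1(2) w2 by linarith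
qed

text \<open>With \<open>a\<close> a difference and \<open>b\<close> a sum, the condition for
  \<open>d\<close> reads \<open>|a| <= b <= 2 * d - |a|\<close>, an interval centred at
  \<open>d\<close>. A sum of at least \<open>d + 1\<close> can afford to lose 2, a smaller one need
  not. In the border case \<open>b = d + 1\<close> parity excludes \<open>|a| = d\<close>; the bound
  \<open>|a| <= d\<close> itself comes from a vertex with value \<open>b1\<close> that
  \<open>A\<close> cuts off.\<close>

lemma bip_raise:
  fixes a b b1 d :: int
  assumes par: "even (a + b)"
    and w: "\<bar>a\<bar> + \<bar>b - (d + 1)\<bar> \<le> d + 1" "\<bar>a\<bar> + \<bar>b - 2 * of_bool p - (d + 1)\<bar> \<le> d + 1"
    and w1: "\<bar>a\<bar> + \<bar>b1 - (d + 1)\<bar> \<le> d + 1" "\<bar>a\<bar> + \<bar>b1 - 2 - (d + 1)\<bar> \<le> d + 1"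
  shows "\<bar>a\<bar> + \<bar>b - 2 * of_bool (p \<or> b \<ge> d + 1) - d\<bar> \<le> d"
proof (cases p)
  case True
  then have "\<bar>a\<bar> + \<bar>b - 2 - (d + 1)\<bar> \<le> d + 1" using w(2) by simp
  then have "\<bar>a\<bar> + \<bar>b - 2 - d\<bar> \<le> d" using w(1) by linarith
  with True show ?thesis by simp
next
  case False
  have a: "\<bar>a\<bar> \<le> d" using w1 by linarith
  have "\<bar>a\<bar> \<le> d - 1" if "b = d + 1"
  proof -
    have "even (\<bar>a\<bar> + (d + 1))" using par that by simp
    then have "\<bar>a\<bar> \<noteq> d" by presburger
    with a show ?thesis by linarith
  qed
  with a w(1) have "if b \<ge> d + 1 then \<bar>a\<bar> + \<bar>b - 2 - d\<bar> \<le> d else \<bar>a\<bar> + \<bar>b - d\<bar> \<le> d"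
    by (cases "b = d + 1"; cases "b \<ge> d + 1") (simp_all; linarith)+
  with False show ?thesis by (auto split: if_splits)
qed

lemma koszul_cuts_bip:
  assumes ab: "a \<noteq> b" "a \<notin> C" "b \<notin> C" and C: "finite C" "C \<noteq> {}"
  shows "koszul_cuts (bip a b C)"
proof (rule koszul_cutsI[where v = a])
  show "card e = 2" if "e \<in> bip a b C" for e
    using that ab card_bip[of a C b] by auto
next
  fix d w A c0
  let ?E = "bip a b C"
  have ne: "a \<noteq> c" "b \<noteq> c" if "c \<in> C" for c using ab that by auto
  assume w: "cut_sum ?E (Suc d) w" "cut_sum ?E (Suc d) (\<lambda>e. w e - cut_ind A e)"
    and aA: "a \<notin> A" and c0: "c0 \<in> ?E" "cut_ind A c0 \<noteq> 0"
  define x y where "x c = w {a, c}" and "y c = w {b, c}" for c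
  have S: "int (Suc d) = int d + 1" by simp
  note w1' = w(1)[unfolded cut_sum_bip[OF assms] S, folded x_def y_def]
  note w2' = w(2)[unfolded cut_sum_bip[OF assms] S, folded x_def y_def]
  have ev: "even (x i + y i + x j + y j)" and
    w1: "\<bar>x i - y i\<bar> + \<bar>x j + y j - (int d + 1)\<bar> \<le> int d + 1" if "i \<in> C" "j \<in> C" for i j
    using w1' that by blast+
  have w2: "\<bar>(x i - cut_ind A {a, i}) - (y i - cut_ind A {b, i})\<bar> +
      \<bar>(x j - cut_ind A {a, j}) + (y j - cut_ind A {b, j}) - (int d + 1)\<bar> \<le> int d + 1"
    and ev2: "even (x i - cut_ind A {a, i} + (y i - cut_ind A {b, i}) + (x j - cut_ind A {a, j}) + (y j - cut_ind A {b, j}))"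
    if "i \<in> C" "j \<in> C" for i j
    using w2' that by blast+
  show "\<exists>Z. (\<forall>e\<in>?E. cut_ind A e \<le> cut_ind Z e) \<and> cut_sum ?E d (\<lambda>e. w e - cut_ind Z e)"
  proof (cases "b \<in> A")
    case True
    show ?thesis
    proof (cases "cut_sum ?E d (\<lambda>e. w e - cut_ind A e)")
      case True then show ?thesis by blast
    next
      case False
      then obtain i j where ij: "i \<in> C" "j \<in> C"
        "\<not> \<bar>x i - cut_ind A {a, i} - (y i - cut_ind A {b, i})\<bar> + \<bar>x j - cut_ind A {a, j} + (y j - cut_ind A {b, j}) - int d\<bar> \<le> int d"
        unfolding cut_sum_bip[OF assms] x_def[symmetric] y_def[symmetric] using ev2 by blast
      have A1: "cut_ind A {a, c} + cut_ind A {b, c} = 1" if "c \<in> C" for c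
        using True aA ne[OF that] by (simp add: cut_ind_pair)
      have eq: "x c - cut_ind A {a, c} - (y c - cut_ind A {b, c}) = (x c - y c) - (cut_ind A {a, c} - cut_ind A {b, c})"
        "x c - cut_ind A {a, c} + (y c - cut_ind A {b, c}) = x c + y c - 1" if "c \<in> C" for c
        using A1[OF that] by linarith+
      have s: "cut_ind A {a, i} - cut_ind A {b, i} = 1 \<or> cut_ind A {a, i} - cut_ind A {b, i} = -1"
        using A1[OF ij(1)] cut_ind_cases[of A "{a, i}"] by linarith
      have Z: "\<bar>x i' - y i'\<bar> + \<bar>x j' + y j' - 2 - int d\<bar> \<le> int d" if i'j': "i' \<in> C" "j' \<in> C" for i' j'
      proof -
        have "\<bar>x i' - y i'\<bar> + \<bar>(x j' + y j' - int d) - 2\<bar> \<le> int d"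
        proof (rule bip_exchange[OF s])
          have "(x i - y i) + (x j + y j - int d) + int d = (x i + y i + x j + y j) - 2 * y i" by simp
          then show "even ((x i - y i) + (x j + y j - int d) + int d)" using ev[OF ij(1,2)] by presburger
          show "\<bar>x i - y i - (cut_ind A {a, i} - cut_ind A {b, i})\<bar> + \<bar>x j + y j - int d - 1\<bar> > int d"
            using ij(3) unfolding eq(1)[OF ij(1)] eq(2)[OF ij(2)] by linarith
          show "\<bar>x i - y i\<bar> + \<bar>x j + y j - int d - 1\<bar> \<le> int d + 1" using w1[OF ij(1,2)] by linarith
          show "\<bar>x i' - y i'\<bar> + \<bar>x j + y j - int d - 1\<bar> \<le> int d + 1" using w1[OF i'j'(1) ij(2)] by linarith
          show "\<bar>x i - y i - (cut_ind A {a, i} - cut_ind A {b, i})\<bar> + \<bar>x j' + y j' - int d - 2\<bar> \<le> int d + 1"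
            using w2[OF ij(1) i'j'(2)] unfolding eq(1)[OF ij(1)] eq(2)[OF i'j'(2)] by linarith
        qed
        then show ?thesis by linarith
      qed
      \<comment> \<open>The cut \<open>C\<close> consists of all edges, so it contains
        \<open>A\<close>. It is a summand whenever \<open>A\<close> is not.\<close>
      have cC: "cut_ind C {a, c} = 1" "cut_ind C {b, c} = 1" if "c \<in> C" for c
        using that ab ne[OF that] by (simp_all add: cut_ind_pair)
      have "cut_sum ?E d (\<lambda>e. w e - cut_ind C e)"
        unfolding cut_sum_bip[OF assms] x_def[symmetric] y_def[symmetric]
      proof (intro ballI conjI)
        fix i j assume ij: "i \<in> C" "j \<in> C"
        show "even (x i - cut_ind C {a, i} + (y i - cut_ind C {b, i}) + (x j - cut_ind C {a, j}) + (y j - cut_ind C {b, j}))"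
          using ev[OF ij] cC[OF ij(1)] cC[OF ij(2)] by presburger
        show "\<bar>x i - cut_ind C {a, i} - (y i - cut_ind C {b, i})\<bar> + \<bar>x j - cut_ind C {a, j} + (y j - cut_ind C {b, j}) - int d\<bar> \<le> int d"
          using Z[OF ij] cC[OF ij(1)] cC[OF ij(2)] by linarith
      qed
      moreover have "\<forall>e\<in>?E. cut_ind A e \<le> cut_ind C e"
        unfolding bip_ball using cC cut_ind_cases[of A] by (metis order.refl zero_le_one)
      ultimately show ?thesis by blast
    qed
  next
    case False
    \<comment> \<open>Besides the vertices of \<open>A\<close>, those with \<open>x c + y c\<close>
      above the centre \<open>d\<close> must move down.\<close>
    let ?Z = "{c \<in> C. c \<in> A \<or> x c + y c \<ge> int d + 1}"
    obtain c1 where c1: "c1 \<in> C" "c1 \<in> A"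
      using c0 aA False ab ne by (auto simp: bip_def cut_ind_pair split: if_splits)
    have A: "cut_ind A {a, c} = of_bool (c \<in> A)" "cut_ind A {b, c} = of_bool (c \<in> A)"
      "cut_ind ?Z {a, c} = of_bool (c \<in> A \<or> x c + y c \<ge> int d + 1)"
      "cut_ind ?Z {b, c} = of_bool (c \<in> A \<or> x c + y c \<ge> int d + 1)" if "c \<in> C" for c
      using that aA False ab ne[OF that] by (simp_all add: cut_ind_pair)
    have "cut_sum ?E d (\<lambda>e. w e - cut_ind ?Z e)"
      unfolding cut_sum_bip[OF assms] x_def[symmetric] y_def[symmetric]
    proof (intro ballI conjI)
      fix i j assume ij: "i \<in> C" "j \<in> C"
      show "even (x i - cut_ind ?Z {a, i} + (y i - cut_ind ?Z {b, i}) + (x j - cut_ind ?Z {a, j}) + (y j - cut_ind ?Z {b, j}))"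
      proof -
        have "even (x1 - p + (y1 - p) + (x2 - q) + (y2 - q)) \<longleftrightarrow> even (x1 + y1 + x2 + y2)" for x1 y1 x2 y2 p q :: int
          by presburger
        then show ?thesis unfolding A[OF ij(1)] A[OF ij(2)] using ev[OF ij] by blast
      qed
      have w1j: "\<bar>x i - y i\<bar> + \<bar>x j + y j - (int d + 1)\<bar> \<le> int d + 1"
        "\<bar>x i - y i\<bar> + \<bar>x j + y j - 2 * of_bool (j \<in> A) - (int d + 1)\<bar> \<le> int d + 1"
        using w1[OF ij] w2[OF ij] unfolding A[OF ij(1)] A[OF ij(2)] by linarith+
      have w1c: "\<bar>x i - y i\<bar> + \<bar>x c1 + y c1 - (int d + 1)\<bar> \<le> int d + 1"
        "\<bar>x i - y i\<bar> + \<bar>x c1 + y c1 - 2 - (int d + 1)\<bar> \<le> int d + 1"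
        using w1[OF ij(1) c1(1)] w2[OF ij(1) c1(1)] c1(2) unfolding A[OF ij(1)] A[OF c1(1)] by simp_all
      have e: "x i - of_bool P - (y i - of_bool P) = x i - y i" "x j - of_bool P + (y j - of_bool P) = x j + y j - 2 * of_bool P" for P
        by simp_all
      have "even ((x i - y i) + (x j + y j))" using ev[OF ij] by presburger
      then have "\<bar>x i - y i\<bar> + \<bar>x j + y j - 2 * of_bool (j \<in> A \<or> x j + y j \<ge> int d + 1) - int d\<bar> \<le> int d"
        using w1j w1c by (rule bip_raise)
      then show "\<bar>x i - cut_ind ?Z {a, i} - (y i - cut_ind ?Z {b, i})\<bar> + \<bar>x j - cut_ind ?Z {a, j} + (y j - cut_ind ?Z {b, j}) - int d\<bar> \<le> int d"
        unfolding A[OF ij(1)] A[OF ij(2)] e .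
    qed
    moreover have "\<forall>e\<in>?E. cut_ind A e \<le> cut_ind ?Z e"
      unfolding bip_ball using A by simp
    ultimately show ?thesis by blast
  qed
qed

section \<open>Gluing at a vertex\<close>

lemma cut_ind_glue:
  assumes E: "\<And>e. e \<in> E1 \<union> E2 \<Longrightarrow> card e = 2"
    and v: "\<And>e1 e2. e1 \<in> E1 \<Longrightarrow> e2 \<in> E2 \<Longrightarrow> e1 \<inter> e2 \<subseteq> {v}"
  obtains A where "\<And>e. e \<in> E1 \<Longrightarrow> cut_ind A e = cut_ind A1 e" "\<And>e. e \<in> E2 \<Longrightarrow> cut_ind A e = cut_ind A2 e"
proof -
  \<comment> \<open>Passing to the complement makes the two sets agree at \<open>v\<close>;
    restricting each to the vertices of its own edges removes any other interference.\<close>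
  obtain A2' where A2': "(v \<in> A2') \<longleftrightarrow> v \<in> A1" "\<And>e. e \<in> E2 \<Longrightarrow> cut_ind A2' e = cut_ind A2 e"
    using cut_ind_avoiding[of E2 v "v \<in> A1" A2] E by auto
  let ?A = "(A1 \<inter> \<Union>E1) \<union> (A2' \<inter> \<Union>E2)"
  have "?A \<inter> e = A1 \<inter> e" if "e \<in> E1" for e using v[OF that] A2'(1) that by blast
  moreover have "?A \<inter> e = A2' \<inter> e" if "e \<in> E2" for e using v[OF _ that] A2'(1) that by blast
  ultimately show ?thesis using that[of ?A] A2'(2) by (simp add: cut_ind_def)
qed

lemma koszul_cuts_glue:
  assumes E: "\<And>e. e \<in> E1 \<union> E2 \<Longrightarrow> card e = 2"
    and v: "\<And>e1 e2. e1 \<in> E1 \<Longrightarrow> e2 \<in> E2 \<Longrightarrow> e1 \<inter> e2 \<subseteq> {v}"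
    and K: "koszul_cuts E1" "koszul_cuts E2"
  shows "koszul_cuts (E1 \<union> E2)"
  unfolding koszul_cuts_def
proof (intro allI impI)
  fix d w A assume w: "cut_sum (E1 \<union> E2) (Suc d) w" "cut_sum (E1 \<union> E2) (Suc d) (\<lambda>e. w e - cut_ind A e)"
  obtain Z1 where Z1: "\<And>e. e \<in> E1 \<Longrightarrow> cut_ind A e \<le> cut_ind Z1 e" "cut_sum E1 d (\<lambda>e. w e - cut_ind Z1 e)"
    using K(1)[unfolded koszul_cuts_def, rule_format, OF w[THEN cut_sum_mono[OF _ Un_upper1]]] by blast
  obtain Z2 where Z2: "\<And>e. e \<in> E2 \<Longrightarrow> cut_ind A e \<le> cut_ind Z2 e" "cut_sum E2 d (\<lambda>e. w e - cut_ind Z2 e)"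
    using K(2)[unfolded koszul_cuts_def, rule_format, OF w[THEN cut_sum_mono[OF _ Un_upper2]]] by blast
  obtain Z where Z: "\<And>e. e \<in> E1 \<Longrightarrow> cut_ind Z e = cut_ind Z1 e" "\<And>e. e \<in> E2 \<Longrightarrow> cut_ind Z e = cut_ind Z2 e"
    by (rule cut_ind_glue[OF E v, where ?A1.0 = Z1 and ?A2.0 = Z2]) blast+
  obtain f1 f2 where f: "\<forall>e\<in>E1. w e - cut_ind Z1 e = (\<Sum>k<d. cut_ind (f1 k) e)"
    "\<forall>e\<in>E2. w e - cut_ind Z2 e = (\<Sum>k<d. cut_ind (f2 k) e)"
    using Z1(2) Z2(2) unfolding cut_sum_def by blast
  have "\<exists>B. (\<forall>e\<in>E1. cut_ind B e = cut_ind (f1 k) e) \<and> (\<forall>e\<in>E2. cut_ind B e = cut_ind (f2 k) e)" for k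
    by (rule cut_ind_glue[OF E v, where ?A1.0 = "f1 k" and ?A2.0 = "f2 k"]) blast+
  then obtain f where "\<And>k. (\<forall>e\<in>E1. cut_ind (f k) e = cut_ind (f1 k) e) \<and> (\<forall>e\<in>E2. cut_ind (f k) e = cut_ind (f2 k) e)"
    by metis
  with f Z have "\<forall>e\<in>E1 \<union> E2. w e - cut_ind Z e = (\<Sum>k<d. cut_ind (f k) e)" by auto
  then have "cut_sum (E1 \<union> E2) d (\<lambda>e. w e - cut_ind Z e)" unfolding cut_sum_def by blast
  moreover have "\<forall>e\<in>E1 \<union> E2. cut_ind A e \<le> cut_ind Z e" using Z1(1) Z2(1) Z by auto
  ultimately show "\<exists>Z. (\<forall>e\<in>E1 \<union> E2. cut_ind A e \<le> cut_ind Z e) \<and> cut_sum (E1 \<union> E2) d (\<lambda>e. w e - cut_ind Z e)"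
    by blast
qed

section \<open>Switching\<close>

definition switch :: "'v set \<Rightarrow> nat \<Rightarrow> ('v set \<Rightarrow> int) \<Rightarrow> 'v set \<Rightarrow> int" where
  "switch A d w e = (if cut_ind A e = 1 then int d - w e else w e)"

text \<open>The symmetric difference with \<open>A\<close>, taken in every summand, flips each
  indicator on the edges cut by \<open>A\<close> and keeps it elsewhere. This is the switching
  symmetry of the cut polytope.\<close>

lemma cut_sum_switch:
  assumes E: "\<And>e. e \<in> E \<Longrightarrow> card e = 2" and w: "cut_sum E d w"
  shows "cut_sum E d (switch A d w)"
proof -
  obtain f where f: "\<forall>e\<in>E. w e = (\<Sum>k<d. cut_ind (f k) e)" using w unfolding cut_sum_def ..
  have "switch A d w e = (\<Sum>k<d. cut_ind (sym_diff A (f k)) e)" if e: "e \<in> E" for e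
  proof (cases "cut_ind A e = 1")
    case True
    have "(\<Sum>k<d. cut_ind (sym_diff A (f k)) e) = (\<Sum>k<d. 1 - cut_ind (f k) e)"
    proof (intro sum.cong)
      show "cut_ind (sym_diff A (f k)) e = 1 - cut_ind (f k) e" for k
        using cut_ind_cases[of "f k" e] True by (auto simp: cut_ind_symdiff[OF E[OF e]])
    qed simp
    also have "\<dots> = int d - w e" using f e by (simp add: sum_subtractf)
    finally show ?thesis using True by (simp add: switch_def)
  next
    case False
    then have "cut_ind A e = 0" using cut_ind_cases[of A e] by simp
    with f e show ?thesis by (simp add: switch_def cut_ind_symdiff[OF E[OF e]] cut_ind_nonneg)
  qed
  then show ?thesis unfolding cut_sum_def by (intro exI[of _ "\<lambda>k. sym_diff A (f k)"]) blast
qed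

text \<open>Switching along \<open>A\<close> permutes the cuts and reduces two arbitrary cuts to the case that one of
  them is the empty cut.\<close>

lemma koszul_cuts_switch:
  assumes E: "\<And>e. e \<in> E \<Longrightarrow> card e = 2" and K: "koszul_cuts E"
    and w: "cut_sum E (Suc d) (\<lambda>e. w e - cut_ind A e)" "cut_sum E (Suc d) (\<lambda>e. w e - cut_ind A' e)"
  obtains B B' where "\<And>e. e \<in> E \<Longrightarrow> cut_ind A e + cut_ind B e = cut_ind A' e + cut_ind B' e"
    "cut_sum E d (\<lambda>e. w e - cut_ind A e - cut_ind B e)"
proof -
  let ?D = "sym_diff A A'"
  note sd = cut_ind_symdiff[OF E] and cc = cut_ind_cases
  \<comment> \<open>Switching turns the summand \<open>A\<close> of \<open>w\<close> into the empty
    cut, so the degree \<open>d + 2\<close> of \<open>w\<close> on the right matches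
    \<open>d + 1\<close> on the left.\<close>
  have "switch A (Suc d) (\<lambda>e. w e - cut_ind A e) e = switch A (Suc (Suc d)) w e" for e
    using cc[of A e] by (auto simp: switch_def)
  then have w1: "cut_sum E (Suc d) (switch A (Suc (Suc d)) w)"
    using cut_sum_switch[OF E w(1), of A] by (simp cong: cut_sum_cong)
  have "switch A (Suc d) (\<lambda>e. w e - cut_ind A' e) e = switch A (Suc (Suc d)) w e - cut_ind ?D e"
    if "e \<in> E" for e
    using cc[of A e] cc[of A' e] by (auto simp: switch_def sd[OF that])
  then have w2: "cut_sum E (Suc d) (\<lambda>e. switch A (Suc (Suc d)) w e - cut_ind ?D e)"
    using cut_sum_switch[OF E w(2), of A] by (simp cong: cut_sum_cong)
  obtain Z where Z: "\<And>e. e \<in> E \<Longrightarrow> cut_ind ?D e \<le> cut_ind Z e"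
    "cut_sum E d (\<lambda>e. switch A (Suc (Suc d)) w e - cut_ind Z e)"
    using K[unfolded koszul_cuts_def, rule_format, OF w1 w2] by blast
  have "switch A d (\<lambda>e. switch A (Suc (Suc d)) w e - cut_ind Z e) e =
      w e - cut_ind A e - cut_ind (sym_diff A Z) e" if "e \<in> E" for e
    using cc[of A e] cc[of Z e] by (auto simp: switch_def sd[OF that])
  then have "cut_sum E d (\<lambda>e. w e - cut_ind A e - cut_ind (sym_diff A Z) e)"
    using cut_sum_switch[OF E Z(2), of A] by (simp cong: cut_sum_cong)
  \<comment> \<open>Here containment is what counts: \<open>Z\<close> contains the symmetric
    difference of \<open>A\<close> and \<open>A'\<close>, so an edge on which \<open>A\<close> and
    \<open>A'\<close> differ is cut by \<open>Z\<close>, and both sums are 1 there.\<close>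
  moreover have "cut_ind A e + cut_ind (sym_diff A Z) e = cut_ind A' e + cut_ind (sym_diff A' Z) e"
    if "e \<in> E" for e
    using Z(1)[OF that] cc[of A e] cc[of A' e] cc[of Z e] by (auto simp: sd[OF that])
  ultimately show ?thesis by (rule that[rotated])
qed


section \<open>Edge sets without long cycles\<close>

abbreviation adj :: "'v set set \<Rightarrow> 'v \<Rightarrow> 'v \<Rightarrow> bool" where
  "adj E x y \<equiv> {x, y} \<in> E"

text \<open>An edge traversed back and forth also counts, as a list of length 2. This is harmless
  since only lists of length at least 5 are ever excluded.\<close>

definition cyclic :: "'v set set \<Rightarrow> 'v list \<Rightarrow> bool" where
  "cyclic E vs \<longleftrightarrow> vs \<noteq> [] \<and> distinct vs \<and> successively (adj E) vs \<and> adj E (last vs) (hd vs)"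

text \<open>Separation is stated for edges, so isolated vertices do not matter; an edge set that
  falls into vertex-disjoint parts is separable as well.\<close>

definition separable :: "'v set set \<Rightarrow> bool" where
  "separable E \<longleftrightarrow> (\<exists>E1 E2 v. E = E1 \<union> E2 \<and> E1 \<inter> E2 = {} \<and> E1 \<noteq> {} \<and> E2 \<noteq> {} \<and>
     (\<forall>e1\<in>E1. \<forall>e2\<in>E2. e1 \<inter> e2 \<subseteq> {v}))"

text \<open>The list \<open>xs\<close> holds the inner vertices only. The last condition keeps an
  ear without inner vertices from being an edge of \<open>F\<close>.\<close>

definition ear :: "'v set set \<Rightarrow> 'v set set \<Rightarrow> 'v \<Rightarrow> 'v list \<Rightarrow> 'v \<Rightarrow> bool" where
  "ear E F p xs q \<longleftrightarrow> p \<in> \<Union>F \<and> q \<in> \<Union>F \<and> p \<noteq> q \<and> distinct xs \<and> set xs \<inter> \<Union>F = {} \<and>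
     successively (adj E) (p # xs @ [q]) \<and> (xs = [] \<longrightarrow> {p, q} \<notin> F)"

lemma rtrancl_distinct_list:
  assumes "(x, y) \<in> R\<^sup>*"
  obtains xs where "xs \<noteq> []" "hd xs = x" "last xs = y" "distinct xs" "successively (\<lambda>u v. (u, v) \<in> R) xs"
proof -
  from assms have "\<exists>xs. xs \<noteq> [] \<and> hd xs = x \<and> last xs = y \<and> distinct xs \<and> successively (\<lambda>u v. (u, v) \<in> R) xs"
  proof (induction rule: converse_rtrancl_induct)
    case base
    show ?case by (rule exI[of _ "[y]"]) simp
  next
    case (step u v)
    then obtain xs where xs: "xs \<noteq> []" "hd xs = v" "last xs = y" "distinct xs"
      "successively (\<lambda>u v. (u, v) \<in> R) xs" by blast
    show ?case
    proof (cases "u \<in> set xs")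
      case False
      with xs step(1) show ?thesis by (intro exI[of _ "u # xs"]) (auto simp: successively_Cons)
    next
      case True
      then obtain ys zs where "xs = ys @ u # zs" by (meson split_list)
      with xs show ?thesis by (intro exI[of _ "u # zs"]) (auto simp: successively_append_iff)
    qed
  qed
  then show ?thesis using that by blast
qed

lemma ear_sym: "ear E F p xs q \<Longrightarrow> ear E F q (rev xs) p"
  unfolding ear_def by (cases "xs = []")
    (auto simp: successively_append_iff successively_Cons insert_commute hd_rev last_rev hd_append)

text \<open>If no edge outside \<open>F\<close> joins two vertices of \<open>F\<close>, take the
  component \<open>R\<close> of an outside vertex in the graph off \<open>F\<close>. The edges
  touching \<open>R\<close> meet the others in vertices of \<open>F\<close> only, and in at least
  two of them by inseparability; a path through \<open>R\<close> joins these two.\<close>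

lemma ear_exists:
  assumes E: "\<And>e. e \<in> E \<Longrightarrow> card e = 2" and sep: "\<not> separable E" and F: "F \<subseteq> E" "F \<noteq> {}" "F \<noteq> E"
  shows "\<exists>p xs q. ear E F p xs q"
proof (cases "\<exists>e\<in>E - F. e \<subseteq> \<Union>F")
  case True
  then obtain e where e: "e \<in> E" "e \<notin> F" "e \<subseteq> \<Union>F" by blast
  then obtain p q where "e = {p, q}" "p \<noteq> q" using E by (meson card_2_iff)
  with e have "ear E F p [] q" by (auto simp: ear_def)
  then show ?thesis by blast
next
  case out: False
  obtain e0 where e0: "e0 \<in> E" "e0 \<notin> F" using F by blast
  with out obtain x where x: "x \<in> e0" "x \<notin> \<Union>F" by blast
  define S where "S = {(u, v). adj E u v \<and> u \<notin> \<Union>F \<and> v \<notin> \<Union>F}"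
  define R where "R = {y. (x, y) \<in> S\<^sup>*}"
  define E' where "E' = {e \<in> E. e \<inter> R \<noteq> {}}"
  have R: "R \<inter> \<Union>F = {}"
  proof -
    have "y \<notin> \<Union>F" if "(x, y) \<in> S\<^sup>*" for y
      using that by (induction rule: rtrancl_induct) (use x(2) in \<open>auto simp: S_def\<close>)
    then show ?thesis by (auto simp: R_def)
  qed
  have xR: "x \<in> R" by (simp add: R_def)
  have step: "z \<in> R" if "r \<in> R" "adj E r z" "z \<notin> \<Union>F" for r z
    using that R unfolding R_def S_def by (auto intro: rtrancl_into_rtrancl)
  have symS: "sym (S\<^sup>*)" by (intro sym_rtrancl) (auto simp: sym_def S_def insert_commute)
  have boundary: "z \<in> \<Union>F \<and> (\<exists>r\<in>R. adj E r z)" if e: "e1 \<in> E'" "e2 \<in> E - E'" "z \<in> e1 \<inter> e2" for e1 e2 z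
  proof -
    obtain r where r: "r \<in> e1" "r \<in> R" "e1 \<in> E" using e(1) by (auto simp: E'_def)
    have "z \<notin> R" using e(2,3) by (auto simp: E'_def)
    then have "z \<noteq> r" using r by blast
    then have "e1 = {r, z}" using E[OF r(3)] r(1) e(3) by (auto simp: card_2_iff)
    with r step[of r z] \<open>z \<notin> R\<close> show ?thesis by auto
  qed
  have "\<not> (\<exists>v. \<forall>e1\<in>E'. \<forall>e2\<in>E - E'. e1 \<inter> e2 \<subseteq> {v})"
  proof
    assume "\<exists>v. \<forall>e1\<in>E'. \<forall>e2\<in>E - E'. e1 \<inter> e2 \<subseteq> {v}"
    moreover have "E' \<noteq> {}" using e0 x xR by (auto simp: E'_def)
    moreover have "F \<subseteq> E - E'" using R F(1) by (auto simp: E'_def)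
    then have "E - E' \<noteq> {}" using F(2) by blast
    moreover have "E = E' \<union> (E - E')" by (auto simp: E'_def)
    ultimately have "separable E" unfolding separable_def by (metis Diff_disjoint)
    with sep show False ..
  qed
  \<comment> \<open>No single vertex contains all intersections: this yields one common vertex
    \<open>p\<close>, and, applied to \<open>p\<close> itself, a second one.\<close>
  then obtain p e1 e2 where p: "e1 \<in> E'" "e2 \<in> E - E'" "p \<in> e1 \<inter> e2" by blast
  with \<open>\<not> (\<exists>v. _ v)\<close> obtain q e3 e4 where q: "e3 \<in> E'" "e4 \<in> E - E'" "q \<in> e3 \<inter> e4" "q \<noteq> p" by blast
  from boundary[OF p] boundary[OF q(1-3)] obtain r r' where r: "p \<in> \<Union>F" "r \<in> R" "adj E r p"
    "q \<in> \<Union>F" "r' \<in> R" "adj E r' q" by blast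
  have "(r, r') \<in> S\<^sup>*" using r(2,5) symS unfolding R_def by (auto dest: symD intro: rtrancl_trans)
  then obtain xs where xs: "xs \<noteq> []" "hd xs = r" "last xs = r'" "distinct xs" "successively (\<lambda>u v. (u, v) \<in> S) xs"
    by (rule rtrancl_distinct_list)
  have "set zs \<inter> \<Union>F = {}" if "successively (\<lambda>u v. (u, v) \<in> S) zs" "zs = [] \<or> hd zs \<notin> \<Union>F" for zs
    using that by (induction zs) (auto simp: S_def successively_Cons)
  then have "set xs \<inter> \<Union>F = {}" using xs(2,5) r(2) R by blast
  moreover have "successively (adj E) xs" using xs(5) by (rule successively_mono) (auto simp: S_def)
  ultimately have "ear E F p xs q" using xs r q(4)
    by (auto simp: ear_def successively_Cons successively_append_iff insert_commute)
  then show ?thesis by blast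
qed

lemma ear_cyclic:
  assumes "ear E F p xs q" "distinct (p # q # ys)" "set ys \<subseteq> \<Union>F"
    "successively (adj E) (q # ys)" "adj E (last (q # ys)) p"
  shows "cyclic E (p # xs @ q # ys)"
  using assms unfolding ear_def cyclic_def
  by (cases "xs = []") (auto simp: successively_Cons successively_append_iff hd_append split: if_splits)

section \<open>Extending \<open>K_{2,n}\<close> and \<open>K_{1,1,n}\<close> by an ear\<close>

definition fan :: "'v \<Rightarrow> 'v \<Rightarrow> 'v set \<Rightarrow> 'v set set" where
  "fan a b C = insert {a, b} (bip a b C)"

text \<open>\<open>C\<close> may be empty in a fan, which makes a single edge a book and gives the
  search for a maximal book its start. \<open>K_{2,1}\<close> is only a path, whence the bound on
  \<open>card C\<close> in the other case.\<close>

definition book :: "'v set set \<Rightarrow> bool" where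
  "book F \<longleftrightarrow> (\<exists>a b C. a \<noteq> b \<and> a \<notin> C \<and> b \<notin> C \<and> finite C \<and> (F = fan a b C \<or> F = bip a b C \<and> 2 \<le> card C))"

lemma book_fan: "a \<noteq> b \<Longrightarrow> a \<notin> C \<Longrightarrow> b \<notin> C \<Longrightarrow> finite C \<Longrightarrow> book (fan a b C)"
  unfolding book_def by blast

lemma book_bip: "a \<noteq> b \<Longrightarrow> a \<notin> C \<Longrightarrow> b \<notin> C \<Longrightarrow> finite C \<Longrightarrow> 2 \<le> card C \<Longrightarrow> book (bip a b C)"
  unfolding book_def by blast

lemma Union_bip: "C \<noteq> {} \<Longrightarrow> \<Union>(bip a b C) = {a, b} \<union> C"
  unfolding bip_def by blast

lemma Union_fan: "\<Union>(fan a b C) = {a, b} \<union> C"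
  unfolding fan_def bip_def by blast

lemma bip_subset: "bip a b C \<subseteq> E \<longleftrightarrow> (\<forall>c\<in>C. adj E a c \<and> adj E b c)"
  unfolding bip_def by blast

lemma fan_subset: "fan a b C \<subseteq> E \<longleftrightarrow> adj E a b \<and> (\<forall>c\<in>C. adj E a c \<and> adj E b c)"
  unfolding fan_def by (auto simp: bip_subset)

lemma bip_mem:
  assumes "c \<in> C"
  shows "{a, c} \<in> bip a b C" "{b, c} \<in> bip a b C" "{c, a} \<in> bip a b C" "{c, b} \<in> bip a b C"
proof -
  show 1: "{a, c} \<in> bip a b C" "{b, c} \<in> bip a b C" using assms unfolding bip_def by blast+
  show "{c, a} \<in> bip a b C" "{c, b} \<in> bip a b C" using 1 by (simp_all add: insert_commute)
qed

lemma fan_mem: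
  "{a, b} \<in> fan a b C"
  "c \<in> C \<Longrightarrow> {a, c} \<in> fan a b C" "c \<in> C \<Longrightarrow> {b, c} \<in> fan a b C"
  "c \<in> C \<Longrightarrow> {c, a} \<in> fan a b C" "c \<in> C \<Longrightarrow> {c, b} \<in> fan a b C"
  unfolding fan_def using bip_mem[of c C] by simp_all

lemma bip_subset_swap: "x \<in> C \<Longrightarrow> y \<in> C \<Longrightarrow> bip x y {a, b} \<subseteq> bip a b C"
  by (simp add: bip_subset bip_mem)

definition k4_free :: "'v set set \<Rightarrow> bool" where
  "k4_free E \<longleftrightarrow> \<not> (\<exists>a b c d. distinct [a, b, c, d] \<and> {{a, b}, {a, c}, {a, d}, {b, c}, {b, d}, {c, d}} \<subseteq> E)"

context
  fixes E :: "'v set set"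
  assumes cyc: "\<And>vs. cyclic E vs \<Longrightarrow> length vs < 5" and k4: "k4_free E"
begin

text \<open>Ear and return path \<open>ys\<close> close up to a cycle with
  \<open>2 + length xs + length ys\<close> vertices, so each case below only has to exhibit a long
  enough \<open>ys\<close>.\<close>

lemma short_cycle:
  assumes "ear E F p xs q" "distinct (p # q # ys)" "set ys \<subseteq> \<Union>F"
    "successively (adj E) (q # ys)" "adj E (last (q # ys)) p"
  shows "length xs + length ys < 3"
  using cyc[OF ear_cyclic[OF assms]] by simp

lemma ear_list_cases:
  assumes "ear E F p xs q"
  obtains "xs = []" "adj E p q" "{p, q} \<notin> F"
  | x where "xs = [x]" "x \<notin> \<Union>F" "adj E p x" "adj E q x"
  | "length xs \<ge> 2"
  using assms unfolding ear_def by (cases xs rule: remdups_adj.cases; force simp: insert_commute)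

lemma bip_extend_ab:
  assumes ab: "a \<noteq> b" "a \<notin> C" "b \<notin> C" "finite C" "2 \<le> card C" and F: "bip a b C \<subseteq> E"
    and ear: "ear E (bip a b C) a xs b"
  shows "\<exists>F'. book F' \<and> F' \<subseteq> E \<and> bip a b C \<subset> F'"
proof -
  have C: "C \<noteq> {}" using ab(5) by auto
  then obtain c where c: "c \<in> C" by blast
  from ear show ?thesis
  proof (cases rule: ear_list_cases)
    case 1
    then have "fan a b C \<subseteq> E" "bip a b C \<subset> fan a b C" using F by (auto simp: fan_def)
    then show ?thesis using book_fan[OF ab(1-4)] by blast
  next
    case (2 x)
    then have "bip a b (insert x C) \<subseteq> E" "x \<notin> C" "x \<noteq> a" "x \<noteq> b"
      using F unfolding bip_subset Union_bip[OF C] by auto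
    moreover have "bip a b C \<subset> bip a b (insert x C)"
    proof
      show "bip a b C \<subseteq> bip a b (insert x C)" by (auto simp: bip_def)
      have "{a, x} \<in> bip a b (insert x C)" by (simp add: bip_def)
      moreover have "{a, x} \<notin> bip a b C" using 2(2) by blast
      ultimately show "bip a b C \<noteq> bip a b (insert x C)" by blast
    qed
    moreover have "book (bip a b (insert x C))" using calculation(2-4) ab by (intro book_bip) auto
    ultimately show ?thesis by blast
  next
    case 3
    have "length xs + length [c] < 3"
      using c ab F by (intro short_cycle[OF ear]) (auto simp: Union_bip[OF C] bip_mem[THEN subsetD[OF F]])
    with 3 show ?thesis by simp
  qed
qed

text \<open>The edge from \<open>a\<close> to \<open>c\<close> is present, so the ear has an inner
  vertex; going back through \<open>b\<close> and a second vertex of \<open>C\<close> gives a cycle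
  of length at least 5.\<close>

lemma bip_extend_ac:
  assumes ab: "a \<noteq> b" "a \<notin> C" "b \<notin> C" "finite C" "2 \<le> card C" and F: "bip a b C \<subseteq> E" and c: "c \<in> C"
    and ear: "ear E (bip a b C) a xs c"
  shows False
proof -
  have C: "C \<noteq> {}" using c by blast
  have "C \<noteq> {c}" using ab(5) by auto
  then obtain c' where c': "c' \<in> C" "c' \<noteq> c" using c by blast
  have "xs \<noteq> []" using ear c by (auto simp: ear_def bip_def)
  moreover have "length xs + length [b, c'] < 3"
    using c c' ab F by (intro short_cycle[OF ear]) (auto simp: Union_bip[OF C] bip_mem[THEN subsetD[OF F]])
  ultimately show False by simp
qed

text \<open>A third vertex \<open>d\<close> of \<open>C\<close> would allow the return path
  \<open>a\<close>, \<open>d\<close>, \<open>b\<close>. So for short ears the book is a four-cycle,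
  and its two sides can exchange roles.\<close>

lemma bip_extend_cc:
  assumes ab: "a \<noteq> b" "a \<notin> C" "b \<notin> C" "finite C" "2 \<le> card C" and F: "bip a b C \<subseteq> E" and c: "c \<in> C" "c' \<in> C"
    and ear: "ear E (bip a b C) c xs c'"
  shows "\<exists>F'. book F' \<and> F' \<subseteq> E \<and> bip a b C \<subset> F'"
proof -
  have C: "C \<noteq> {}" using c by blast
  have cc: "c \<noteq> c'" using ear by (simp add: ear_def)
  from ear show ?thesis
  proof (cases rule: ear_list_cases)
    case 1
    have C2: "C = {c, c'}"
    proof (rule ccontr)
      assume "C \<noteq> {c, c'}"
      then obtain d where d: "d \<in> C" "d \<noteq> c" "d \<noteq> c'" using c by blast
      have "length xs + length [a, d, b] < 3"
        using c cc d ab F by (intro short_cycle[OF ear]) (auto simp: Union_bip[OF C] bip_mem[THEN subsetD[OF F]])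
      then show False by simp
    qed
    have "fan c c' {a, b} \<subseteq> E" using 1 subset_trans[OF bip_subset_swap[OF c] F] by (simp add: fan_def)
    moreover have "bip a b C \<subseteq> fan c c' {a, b}"
      unfolding bip_subset by (simp add: C2 fan_mem)
    then have "bip a b C \<subset> fan c c' {a, b}" using 1 fan_mem(1)[of c c'] by blast
    moreover have "book (fan c c' {a, b})" using c cc ab by (intro book_fan) auto
    ultimately show ?thesis by blast
  next
    case (2 x)
    have C2: "C = {c, c'}"
    proof (rule ccontr)
      assume "C \<noteq> {c, c'}"
      then obtain d where d: "d \<in> C" "d \<noteq> c" "d \<noteq> c'" using c by blast
      have "length xs + length [a, d, b] < 3"
        using c cc d ab F by (intro short_cycle[OF ear]) (auto simp: Union_bip[OF C] bip_mem[THEN subsetD[OF F]])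
      then show False by simp
    qed
    have x: "x \<notin> C" "x \<noteq> a" "x \<noteq> b" using 2(2) by (auto simp: Union_bip[OF C])
    have "bip c c' {a, b, x} \<subseteq> E" using 2 subset_trans[OF bip_subset_swap[OF c] F] by (simp add: bip_subset)
    moreover have "bip a b C \<subset> bip c c' {a, b, x}"
    proof
      show "bip a b C \<subseteq> bip c c' {a, b, x}" unfolding bip_subset by (simp add: C2 bip_mem)
      have "{c, x} \<in> bip c c' {a, b, x}" by (simp add: bip_def)
      moreover have "{c, x} \<notin> bip a b C" using 2(2) by blast
      ultimately show "bip a b C \<noteq> bip c c' {a, b, x}" by blast
    qed
    moreover have "book (bip c c' {a, b, x})" using c cc ab x by (intro book_bip) auto
    ultimately show ?thesis by blast
  next
    case 3
    have "length xs + length [a] < 3"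
      using c cc ab F by (intro short_cycle[OF ear]) (auto simp: Union_bip[OF C] bip_mem[THEN subsetD[OF F]])
    with 3 show ?thesis by simp
  qed
qed

lemma fan_extend_ab:
  assumes ab: "a \<noteq> b" "a \<notin> C" "b \<notin> C" "finite C" and F: "fan a b C \<subseteq> E"
    and ear: "ear E (fan a b C) a xs b"
  shows "\<exists>F'. book F' \<and> F' \<subseteq> E \<and> fan a b C \<subset> F'"
  using ear
proof (cases rule: ear_list_cases)
  case 1
  then show ?thesis by (simp add: fan_def)
next
  case (2 x)
  then have "fan a b (insert x C) \<subseteq> E" "x \<notin> C" "x \<noteq> a" "x \<noteq> b"
    using F unfolding fan_subset Union_fan by auto
  moreover have "fan a b C \<subset> fan a b (insert x C)"
  proof
    show "fan a b C \<subseteq> fan a b (insert x C)" by (auto simp: fan_def bip_def)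
    have "{a, x} \<in> fan a b (insert x C)" by (simp add: fan_def bip_def)
    moreover have "{a, x} \<notin> fan a b C" using 2(2) by blast
    ultimately show "fan a b C \<noteq> fan a b (insert x C)" by blast
  qed
  moreover have "book (fan a b (insert x C))" using calculation(2-4) ab by (intro book_fan) auto
  ultimately show ?thesis by blast
next
  case 3
  show ?thesis
  proof (cases "C = {}")
    case False
    then obtain c where c: "c \<in> C" by blast
    have "length xs + length [c] < 3"
      using c ab F by (intro short_cycle[OF ear]) (auto simp: Union_fan fan_mem[THEN subsetD[OF F]] insert_commute[of b a])
    with 3 show ?thesis by simp
  next
    \<comment> \<open>The book is the single edge \<open>{a, b}\<close>. An ear with exactly two
      inner vertices completes it to a four-cycle, which is a \<open>K_{2,2}\<close>.\<close>
    case True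
    have "length xs + length ([] :: 'v list) < 3"
      using ab F by (intro short_cycle[OF ear]) (auto simp: Union_fan fan_mem[THEN subsetD[OF F]] insert_commute[of b a])
    with 3 obtain x y where xy: "xs = [x, y]" by (auto simp: numeral_eq_Suc length_Suc_conv less_Suc_eq)
    then have ne: "x \<noteq> y" "x \<noteq> a" "x \<noteq> b" "y \<noteq> a" "y \<noteq> b" "adj E a x" "adj E x y" "adj E y b"
      using ear by (auto simp: ear_def Union_fan)
    have "bip a y {x, b} \<subseteq> E" using ne F by (simp add: bip_subset fan_subset insert_commute[of y x])
    moreover have "fan a b C \<subset> bip a y {x, b}"
    proof
      show "fan a b C \<subseteq> bip a y {x, b}" using True by (simp add: fan_subset bip_mem)
      have "{a, x} \<in> bip a y {x, b}" by (simp add: bip_mem)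
      moreover have "{a, x} \<notin> fan a b C" using True ne ab by (simp add: fan_def bip_def doubleton_eq_iff)
      ultimately show "fan a b C \<noteq> bip a y {x, b}" by blast
    qed
    moreover have "book (bip a y {x, b})" using ne ab by (intro book_bip) auto
    ultimately show ?thesis by blast
  qed
qed

text \<open>A second vertex of \<open>C\<close> would allow a return path through \<open>b\<close>
  and that vertex. So the book is a triangle, any edge of which may be taken as the spine, here
  \<open>{a, c}\<close>.\<close>

lemma fan_extend_ac:
  assumes ab: "a \<noteq> b" "a \<notin> C" "b \<notin> C" "finite C" and F: "fan a b C \<subseteq> E" and c: "c \<in> C"
    and ear: "ear E (fan a b C) a xs c"
  shows "\<exists>F'. book F' \<and> F' \<subseteq> E \<and> fan a b C \<subset> F'"
proof -
  have ne: "xs \<noteq> []" using ear c by (auto simp: ear_def bip_def fan_def)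
  have C: "C = {c}"
  proof (rule ccontr)
    assume "C \<noteq> {c}"
    then obtain c' where c': "c' \<in> C" "c' \<noteq> c" using c by blast
    have "length xs + length [b, c'] < 3"
      using c c' ab F by (intro short_cycle[OF ear]) (auto simp: Union_fan fan_mem[THEN subsetD[OF F]] insert_commute[of b a])
    with ne show False by simp
  qed
  have "length xs + length [b] < 3"
    using c ab F by (intro short_cycle[OF ear]) (auto simp: Union_fan fan_mem[THEN subsetD[OF F]] insert_commute[of b a])
  with ear ne obtain x where x: "x \<notin> \<Union>(fan a b C)" "adj E a x" "adj E c x"
    by (cases rule: ear_list_cases) auto
  have "fan a c {b, x} \<subseteq> E" using x F c by (simp add: fan_subset insert_commute[of c b])
  moreover have "fan a b C \<subset> fan a c {b, x}"
  proof
    show "fan a b C \<subseteq> fan a c {b, x}" unfolding fan_subset by (simp add: C fan_mem)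
    have "{a, x} \<in> fan a c {b, x}" by (simp add: bip_def fan_def)
    moreover have "{a, x} \<notin> fan a b C" using x(1) by blast
    ultimately show "fan a b C \<noteq> fan a c {b, x}" by blast
  qed
  moreover have "book (fan a c {b, x})" using c ab x by (intro book_fan) (auto simp: Union_fan)
  ultimately show ?thesis by blast
qed

text \<open>The return path \<open>a\<close>, \<open>b\<close> forces the ear to be an edge, and
  this edge completes a \<open>K_4\<close>.\<close>

lemma fan_extend_cc:
  assumes ab: "a \<noteq> b" "a \<notin> C" "b \<notin> C" "finite C" and F: "fan a b C \<subseteq> E" and c: "c \<in> C" "c' \<in> C"
    and ear: "ear E (fan a b C) c xs c'"
  shows False
proof -
  have cc: "c \<noteq> c'" using ear by (simp add: ear_def)
  have "length xs + length [a, b] < 3"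
    using c cc ab F by (intro short_cycle[OF ear]) (auto simp: Union_fan fan_mem[THEN subsetD[OF F]] insert_commute[of b a])
  then have "xs = []" by simp
  then have "adj E c c'" using ear by (simp add: ear_def)
  then have "{{a, b}, {a, c}, {a, c'}, {b, c}, {b, c'}, {c, c'}} \<subseteq> E" "distinct [a, b, c, c']"
    using F c cc ab by (auto simp: fan_subset)
  with k4 show False unfolding k4_free_def by blast
qed

lemma book_extend:
  assumes F: "book F" "F \<subseteq> E" and ear: "ear E F p xs q"
  shows "\<exists>F'. book F' \<and> F' \<subseteq> E \<and> F \<subset> F'"
proof -
  obtain a b C where ab: "a \<noteq> b" "a \<notin> C" "b \<notin> C" "finite C" and "F = fan a b C \<or> F = bip a b C \<and> 2 \<le> card C"
    using F(1) unfolding book_def by blast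
  then consider "F = fan a b C" | "F = bip a b C" "2 \<le> card C" by blast
  then show ?thesis
  proof cases
    case 1
    note F' = F(2)[unfolded 1]
    have com: "fan a b C = fan b a C" unfolding fan_def bip_commute[of a] insert_commute[of a] ..
    note ext = fan_extend_ab[OF ab F'] fan_extend_ab[OF ab(1)[symmetric] ab(3,2,4) F'[unfolded com], folded com]
      fan_extend_ac[OF ab F'] fan_extend_ac[OF ab(1)[symmetric] ab(3,2,4) F'[unfolded com], folded com]
      fan_extend_cc[OF ab F']
    have "p \<in> {a, b} \<union> C" "q \<in> {a, b} \<union> C" "p \<noteq> q" using ear unfolding ear_def 1 Union_fan by blast+
    then show ?thesis using ext ear ear_sym[OF ear] unfolding 1 by blast
  next
    case 2
    note F' = F(2)[unfolded 2(1)]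
    have com: "bip a b C = bip b a C" by (rule bip_commute)
    note ext = bip_extend_ab[OF ab 2(2) F'] bip_extend_ab[OF ab(1)[symmetric] ab(3,2,4) 2(2) F'[unfolded com], folded com]
      bip_extend_ac[OF ab 2(2) F'] bip_extend_ac[OF ab(1)[symmetric] ab(3,2,4) 2(2) F'[unfolded com], folded com]
      bip_extend_cc[OF ab 2(2) F']
    have "C \<noteq> {}" using 2(2) by force
    then have "p \<in> {a, b} \<union> C" "q \<in> {a, b} \<union> C" "p \<noteq> q" using ear Union_bip[of C a b] unfolding ear_def 2(1) by blast+
    then show ?thesis using ext ear ear_sym[OF ear] unfolding 2(1) by blast
  qed
qed

lemma inseparable_book:
  assumes E: "\<And>e. e \<in> E \<Longrightarrow> card e = 2" and fin: "finite E" and sep: "\<not> separable E" and ne: "E \<noteq> {}"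
  shows "book E"
proof -
  obtain e where e: "e \<in> E" using ne by blast
  then obtain x y where "e = {x, y}" "x \<noteq> y" using E by (meson card_2_iff)
  then have "book {e}" using book_fan[of x y "{}"] by (simp add: fan_def bip_def)
  then have "{F. book F \<and> F \<subseteq> E} \<noteq> {}" using e by blast
  moreover have "finite {F. book F \<and> F \<subseteq> E}" using fin by simp
  ultimately obtain F where F: "book F" "F \<subseteq> E" and max: "\<And>F'. book F' \<Longrightarrow> F' \<subseteq> E \<Longrightarrow> \<not> F \<subset> F'"
    using finite_has_maximal[of "{F. book F \<and> F \<subseteq> E}"] by (auto simp: psubset_eq)
  have "F = E"
  proof (rule ccontr)
    assume "F \<noteq> E"
    moreover have "F \<noteq> {}" using F(1) unfolding book_def fan_def bip_def by fastforce
    ultimately obtain p xs q where "ear E F p xs q" using ear_exists[OF E sep F(2)] by blast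
    from book_extend[OF F this] max show False by blast
  qed
  with F show ?thesis by simp
qed

end

lemma koszul_cuts_book: "book E \<Longrightarrow> koszul_cuts E"
  unfolding book_def fan_def
  using koszul_cuts_triangles koszul_cuts_bip by (metis card.empty not_numeral_le_zero)

lemma koszul_cuts_if_no_long_cycle:
  assumes "finite E" "\<And>e. e \<in> E \<Longrightarrow> card e = 2" "\<And>vs. cyclic E vs \<Longrightarrow> length vs < 5" "k4_free E"
  shows "koszul_cuts E"
  using assms
proof (induction E rule: finite_psubset_induct)
  case (psubset E)
  have sub: "koszul_cuts F" if "F \<subset> E" for F
  proof (rule psubset.IH[OF that])
    show "card e = 2" if "e \<in> F" for e using \<open>F \<subset> E\<close> that psubset.prems(1) by blast
    show "length vs < 5" if "cyclic F vs" for vs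
    proof (rule psubset.prems(2))
      have "successively (adj E) vs" using that \<open>F \<subset> E\<close> unfolding cyclic_def
        by (blast intro: successively_mono[of "adj F"])
      then show "cyclic E vs" using that \<open>F \<subset> E\<close> unfolding cyclic_def by blast
    qed
    show "k4_free F" using psubset.prems(3) that unfolding k4_free_def
      by (meson psubset_imp_subset subset_trans)
  qed
  show ?case
  proof (cases "separable E")
    case True
    then obtain E1 E2 v where "E = E1 \<union> E2" "E1 \<inter> E2 = {}" "E1 \<noteq> {}" "E2 \<noteq> {}"
      and v: "\<forall>e1\<in>E1. \<forall>e2\<in>E2. e1 \<inter> e2 \<subseteq> {v}" unfolding separable_def by blast
    then have sub': "E1 \<subset> E" "E2 \<subset> E" and E: "E = E1 \<union> E2" by blast+
    have "koszul_cuts E1" "koszul_cuts E2" using sub sub' by blast+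
    with v psubset.prems(1) show ?thesis unfolding E by (intro koszul_cuts_glue[of E1 E2 v]) auto
  next
    case False
    show ?thesis
    proof (cases "E = {}")
      case True
      then show ?thesis by (simp add: koszul_cuts_def cut_sum_def)
    next
      case ne: False
      have "book E" using psubset.prems(2,3) by (rule inseparable_book) (use psubset.prems(1) psubset.hyps False ne in auto)
      then show ?thesis by (rule koszul_cuts_book)
    qed
  qed
qed


section \<open>Minors from cycles and from \<open>K\<^sub>4\<close>\<close>

lemma reduces_to_trans: "reduces_to H K \<Longrightarrow> reduces_to G H \<Longrightarrow> reduces_to G K"
  by (induction rule: reduces_to.induct) (auto intro: reduces_to.intros)

lemma is_minor_trans: "reduces_to G G' \<Longrightarrow> is_minor H G' \<Longrightarrow> is_minor H G"
  unfolding is_minor_def by (blast intro: reduces_to_trans)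

lemma fin_simple_graph_finite_edges: "fin_simple_graph G \<Longrightarrow> finite (edges G)"
  unfolding fin_simple_graph_def by (metis Pow_iff finite_Pow_iff finite_subset subsetI)

lemma fin_simple_contract: "fin_simple_graph G \<Longrightarrow> x \<in> verts G \<Longrightarrow> x \<noteq> y \<Longrightarrow> fin_simple_graph (contract_edge x y G)"
  unfolding fin_simple_graph_def contract_edge_def by fastforce

lemma contract_edge_keep: "e \<in> edges G \<Longrightarrow> card e = 2 \<Longrightarrow> y \<notin> e \<Longrightarrow> e \<in> edges (contract_edge x y G)"
proof -
  assume e: "e \<in> edges G" "card e = 2" "y \<notin> e"
  then have "(\<lambda>z. if z = y then x else z) ` e = e" by (auto simp: image_def)
  with e show ?thesis unfolding contract_edge_def by (auto intro!: rev_image_eqI[of e])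
qed

lemma contract_edge_shift: "{y, z} \<in> edges G \<Longrightarrow> z \<noteq> y \<Longrightarrow> z \<noteq> x \<Longrightarrow> {x, z} \<in> edges (contract_edge x y G)"
proof -
  assume e: "{y, z} \<in> edges G" "z \<noteq> y" "z \<noteq> x"
  then have "(\<lambda>z. if z = y then x else z) ` {y, z} = {x, z}" "card {x, z} = 2" by auto
  with e(1) show ?thesis unfolding contract_edge_def by (auto intro!: rev_image_eqI[of "{y, z}"])
qed

text \<open>Walks are pushed forward along the renaming \<open>r\<close>; a step along the
  contracted edge becomes stationary.\<close>

lemma connected_contract:
  assumes "connected_graph G" "x \<in> verts G" "x \<noteq> y"
  shows "connected_graph (contract_edge x y G)"
proof -
  define r where "r z = (if z = y then x else z)" for z
  let ?S = "{(a, b). {a, b} \<in> edges (contract_edge x y G)}"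
  have step: "(r a, r b) \<in> ?S\<^sup>*" if "{a, b} \<in> edges G" for a b
  proof (cases "r a = r b")
    case False
    have "(\<lambda>z. if z = y then x else z) ` {a, b} = {r a, r b}" by (auto simp: r_def)
    then have "{r a, r b} \<in> (\<lambda>e. (\<lambda>z. if z = y then x else z) ` e) ` edges G" using that by blast
    with False have "(r a, r b) \<in> ?S" unfolding contract_edge_def by simp
    then show ?thesis by blast
  qed simp
  have "(r a, r b) \<in> ?S\<^sup>*" if "(a, b) \<in> {(a, b). {a, b} \<in> edges G}\<^sup>*" for a b
    using that by induction (auto dest: step intro: rtrancl_trans)
  moreover have "r z = z" if "z \<noteq> y" for z using that by (simp add: r_def)
  ultimately have "(a, b) \<in> ?S\<^sup>*" if "a \<in> verts G - {y}" "b \<in> verts G - {y}" for a b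
    using that assms(1) unfolding connected_graph_def by (metis DiffE insertI1)
  then show ?thesis using assms(2,3) unfolding connected_graph_def
    by (auto simp: contract_edge_def)
qed

lemma reduces_to_delete_edges:
  assumes "finite D" "D \<subseteq> edges G"
  shows "reduces_to G (verts G, edges G - D)"
  using assms
proof (induction D rule: finite_induct)
  case empty
  show ?case by (simp add: reduces_to.refl)
next
  case (insert e D)
  then have "reduces_to G (delete_edge e (verts G, edges G - D))"
    by (intro reduces_to.delete) auto
  moreover have "edges G - insert e D = edges G - D - {e}" by blast
  ultimately show ?case by (simp add: delete_edge_def)
qed

text \<open>Connectedness allows to contract the vertices outside \<open>W\<close> into \<open>W\<close> one after the other.\<close>

lemma reduces_to_subgraph:
  assumes "fin_simple_graph G" "connected_graph G" "W \<subseteq> verts G" "W \<noteq> {}" "F \<subseteq> edges G" "\<And>e. e \<in> F \<Longrightarrow> e \<subseteq> W"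
  shows "reduces_to G (W, F)"
  using assms
proof (induction "card (verts G - W)" arbitrary: G)
  case 0
  have "finite (verts G)" using 0 by (simp add: fin_simple_graph_def)
  then have W: "verts G = W" using 0 by auto
  have "edges G - (edges G - F) = F" using 0 by blast
  moreover have "reduces_to G (verts G, edges G - (edges G - F))"
    using 0 by (intro reduces_to_delete_edges) (auto simp: fin_simple_graph_finite_edges)
  ultimately show ?case using W by simp
next
  case (Suc n)
  have fin: "finite (verts G)" using Suc.prems by (simp add: fin_simple_graph_def)
  obtain w z where wz: "w \<in> W" "z \<in> verts G" "z \<notin> W"
    using Suc.prems(4) Suc.hyps(2) by (metis DiffE card.empty equals0I nat.distinct(1))
  have "(w, z) \<in> {(a, b). {a, b} \<in> edges G}\<^sup>*"
    using Suc.prems(2,3) wz unfolding connected_graph_def by blast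
  \<comment> \<open>Some edge on the way from \<open>w\<close> to \<open>z\<close> leaves
    \<open>W\<close>. Its outer end \<open>y\<close> is contracted into \<open>W\<close>, and
    \<open>F\<close> is unaffected because its edges avoid \<open>y\<close>.\<close>
  then have "w \<in> W \<longrightarrow> z \<notin> W \<longrightarrow> (\<exists>x y. {x, y} \<in> edges G \<and> x \<in> W \<and> y \<notin> W)"
    by induction blast+
  then obtain x y where xy: "{x, y} \<in> edges G" "x \<in> W" "y \<notin> W" using wz by blast
  have y: "y \<in> verts G" using Suc.prems(1) xy(1) unfolding fin_simple_graph_def by blast
  have ne: "x \<noteq> y" using xy by blast
  let ?G = "contract_edge x y G"
  have vG: "verts ?G = verts G - {y}" by (simp add: contract_edge_def)
  have "reduces_to ?G (W, F)"
  proof (rule Suc.hyps(1))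
    have "verts ?G - W = (verts G - W) - {y}" by (auto simp: vG)
    then show "n = card (verts ?G - W)" using Suc.hyps(2) fin y xy(3) by simp
    show "fin_simple_graph ?G" using Suc.prems(1,3) xy ne by (intro fin_simple_contract) auto
    show "connected_graph ?G" using Suc.prems(2,3) xy ne by (intro connected_contract) auto
    show "W \<subseteq> verts ?G" using Suc.prems(3) xy by (auto simp: vG)
    show "F \<subseteq> edges ?G"
    proof
      fix e assume "e \<in> F"
      then show "e \<in> edges ?G" using Suc.prems xy unfolding fin_simple_graph_def
        by (intro contract_edge_keep) blast+
    qed
  qed (use Suc.prems in auto)
  moreover have "reduces_to G ?G" using xy(1) ne by (intro reduces_to.contract reduces_to.refl)
  ultimately show ?case by (rule reduces_to_trans)
qed

lemma image_pairs:
  assumes "bij_betw f A B"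
  shows "(\<lambda>e. f ` e) ` {e. e \<subseteq> A \<and> card e = 2} = {e. e \<subseteq> B \<and> card e = 2}"
proof
  have inj: "inj_on f A" and fA: "f ` A = B" using assms by (auto simp: bij_betw_def)
  show "(\<lambda>e. f ` e) ` {e. e \<subseteq> A \<and> card e = 2} \<subseteq> {e. e \<subseteq> B \<and> card e = 2}"
    using fA inj by (auto simp: card_image inj_on_subset)
  show "{e. e \<subseteq> B \<and> card e = 2} \<subseteq> (\<lambda>e. f ` e) ` {e. e \<subseteq> A \<and> card e = 2}"
  proof
    fix e assume e: "e \<in> {e. e \<subseteq> B \<and> card e = 2}"
    then obtain e' where e': "e' \<subseteq> A" "e = f ` e'" using fA by (metis mem_Collect_eq subset_imageE)
    then have "card e' = 2" using e card_image[OF inj_on_subset[OF inj e'(1)]] by simp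
    with e' show "e \<in> (\<lambda>e. f ` e) ` {e. e \<subseteq> A \<and> card e = 2}" by blast
  qed
qed

lemma k4_free_if_no_minor:
  assumes G: "fin_simple_graph G" "connected_graph G" and minor: "\<not> is_minor (complete_graph 4) G"
  shows "k4_free (edges G)"
  unfolding k4_free_def
proof
  assume "\<exists>a b c d. distinct [a, b, c, d] \<and> {{a, b}, {a, c}, {a, d}, {b, c}, {b, d}, {c, d}} \<subseteq> edges G"
  then obtain a b c d where d: "distinct [a, b, c, d]"
    and E: "{{a, b}, {a, c}, {a, d}, {b, c}, {b, d}, {c, d}} \<subseteq> edges G" by (elim exE conjE)
  let ?W = "{a, b, c, d}" and ?F = "{e. e \<subseteq> {a, b, c, d} \<and> card e = 2}"
  have F: "?F \<subseteq> edges G"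
  proof
    fix e assume "e \<in> ?F"
    then obtain x y where "e = {x, y}" "x \<noteq> y" "x \<in> ?W" "y \<in> ?W" by (auto simp: card_2_iff)
    then show "e \<in> edges G" using E by (auto simp: insert_commute)
  qed
  have "{a, b} \<in> edges G" "{c, d} \<in> edges G" using E by simp_all
  then have "{a, b} \<subseteq> verts G" "{c, d} \<subseteq> verts G" using G(1) unfolding fin_simple_graph_def by metis+
  then have "?W \<subseteq> verts G" by simp
  then have "reduces_to G (?W, ?F)" using G F by (intro reduces_to_subgraph) auto
  moreover have "card ?W = 4" using d by simp
  then obtain f where "bij_betw f ?W {..<4::nat}"
    by (metis card_lessThan finite_lessThan finite_same_card_bij finite.emptyI finite_insert)
  then have "graph_iso (?W, ?F) (complete_graph 4)"
    unfolding graph_iso_def complete_graph_def using image_pairs by (intro exI[of _ f]) simp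
  ultimately show False using minor unfolding is_minor_def by blast
qed

lemma cyclic_vertices: "fin_simple_graph G \<Longrightarrow> cyclic (edges G) vs \<Longrightarrow> set vs \<subseteq> verts G"
proof -
  assume G: "fin_simple_graph G" and c: "cyclic (edges G) vs"
  have "set vs \<subseteq> insert (hd vs) (\<Union>(edges G))" if "successively (adj (edges G)) vs" for vs
    using that by (induction vs rule: induct_list012) auto
  with c have "set vs \<subseteq> \<Union>(edges G)" unfolding cyclic_def by blast
  then show ?thesis using G unfolding fin_simple_graph_def by blast
qed

lemma cyclic_contract:
  assumes G: "fin_simple_graph G" and c: "cyclic (edges G) (x # y # z # vs)"
  shows "cyclic (edges (contract_edge x y G)) (x # z # vs)"
proof -
  let ?E = "edges (contract_edge x y G)"
  have keep: "{a, b} \<in> ?E" if "{a, b} \<in> edges G" "y \<noteq> a" "y \<noteq> b" for a b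
    using that G by (intro contract_edge_keep) (auto simp: fin_simple_graph_def)
  have "successively (adj ?E) zs" if "successively (adj (edges G)) zs" "y \<notin> set zs" for zs
    using that by (induction zs rule: induct_list012) (auto intro: keep)
  then have "successively (adj ?E) (z # vs)" using c by (auto simp: cyclic_def)
  moreover have "{x, z} \<in> ?E" using c by (intro contract_edge_shift) (auto simp: cyclic_def)
  moreover have "{last (z # vs), x} \<in> ?E"
  proof (rule keep)
    show "{last (z # vs), x} \<in> edges G" using c by (simp add: cyclic_def)
    have "last (z # vs) \<in> set (z # vs)" by (rule last_in_set) simp
    then show "y \<noteq> last (z # vs)" using c unfolding cyclic_def by auto
    show "y \<noteq> x" using c by (auto simp: cyclic_def)
  qed
  ultimately show ?thesis using c by (auto simp: cyclic_def)
qed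

lemma cycle_graph_5: "cycle_graph 5 = ({0, 1, 2, 3, 4}, {{0, 1}, {1, 2}, {2, 3}, {3, 4}, {4, 0}})"
proof -
  have "{..<5::nat} = {0, 1, 2, 3, 4}" by auto
  moreover have "{{i, (i + 1) mod 5} | i. i < 5} = (\<lambda>i. {i, (i + 1) mod 5}) ` {..<5::nat}" by auto
  ultimately show ?thesis unfolding cycle_graph_def by (simp add: numeral_2_eq_2)
qed

text \<open>Contracting an edge of the cycle shortens it by exactly one, so length 5 is eventually
  hit; there everything off the cycle is removed.\<close>

lemma C5_minor_if_long_cycle:
  assumes "fin_simple_graph G" "connected_graph G" "cyclic (edges G) vs" "5 \<le> length vs"
  shows "is_minor (cycle_graph 5) G"
  using assms
proof (induction "length vs" arbitrary: vs G rule: less_induct)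
  case less
  note V = cyclic_vertices[OF less.prems(1,3)]
  show ?case
  proof (cases "length vs = 5")
    case True
    then obtain a b c d e where vs: "vs = [a, b, c, d, e]" by (auto simp: numeral_eq_Suc length_Suc_conv)
    let ?W = "{a, b, c, d, e}" and ?F = "{{a, b}, {b, c}, {c, d}, {d, e}, {e, a}}"
    have "reduces_to G (?W, ?F)"
      using less.prems V by (intro reduces_to_subgraph) (auto simp: cyclic_def vs)
    moreover have "graph_iso (?W, ?F) (cycle_graph 5)"
    proof -
      define f where "f = (\<lambda>x. if x = a then 0::nat else if x = b then 1 else if x = c then 2 else if x = d then 3 else 4)"
      have f: "f a = 0" "f b = 1" "f c = 2" "f d = 3" "f e = 4"
        using less.prems(3) by (auto simp: cyclic_def vs f_def)
      have "bij_betw f ?W {0, 1, 2, 3, 4}" unfolding bij_betw_def inj_on_def by (simp add: f)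
      then show ?thesis unfolding graph_iso_def cycle_graph_5 by (intro exI[of _ f]) (simp add: f)
    qed
    ultimately show ?thesis unfolding is_minor_def by blast
  next
    case False
    then obtain x y z ws where vs: "vs = x # y # z # ws"
      using less.prems(4) by (cases vs rule: remdups_adj.cases) (auto simp: neq_Nil_conv Suc_le_length_iff numeral_eq_Suc)
    have xy: "{x, y} \<in> edges G" "x \<noteq> y" "x \<in> verts G" using less.prems(3) V by (auto simp: cyclic_def vs)
    have "is_minor (cycle_graph 5) (contract_edge x y G)"
    proof (rule less.hyps)
      show "cyclic (edges (contract_edge x y G)) (x # z # ws)"
        using less.prems(1,3) unfolding vs by (rule cyclic_contract)
    qed (use less.prems False xy vs in \<open>auto intro: fin_simple_contract connected_contract\<close>)
    then show ?thesis by (rule is_minor_trans[rotated]) (use xy in \<open>intro reduces_to.contract reduces_to.refl\<close>)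
  qed
qed


section \<open>Contractions\<close>

text \<open>A minor obtained by contractions is a map on the vertices; its fibers are connected, which is
  expressed by the absence of a nonconstant function without jumps along the edges of a fiber.\<close>

definition connected_fibers :: "'v ugraph \<Rightarrow> ('v \<Rightarrow> 'w) \<Rightarrow> bool" where
  "connected_fibers G f \<longleftrightarrow> (\<forall>g :: 'v \<Rightarrow> bool. (\<forall>x y. {x, y} \<in> edges G \<longrightarrow> f x = f y \<longrightarrow> g x = g y) \<longrightarrow>
     (\<forall>x\<in>verts G. \<forall>y\<in>verts G. f x = f y \<longrightarrow> g x = g y))"

text \<open>A relation on labels, possible also for \<open>a = b\<close> through an edge inside a
  fiber; there \<open>label_cut\<close> vanishes, so such pairs are harmless in the identities
  below.\<close>

definition quotient_adj :: "'v ugraph \<Rightarrow> ('v \<Rightarrow> 'w) \<Rightarrow> 'w \<Rightarrow> 'w \<Rightarrow> bool" where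
  "quotient_adj G f a b \<longleftrightarrow> (\<exists>x y. {x, y} \<in> edges G \<and> f x = a \<and> f y = b)"

lemma quotient_adj_sym: "quotient_adj G f a b \<Longrightarrow> quotient_adj G f b a"
  unfolding quotient_adj_def by (metis insert_commute)

lemma connected_fibersD:
  assumes "connected_fibers G f" "\<And>x y. {x, y} \<in> edges G \<Longrightarrow> f x = f y \<Longrightarrow> g x \<longleftrightarrow> g y"
    "x \<in> verts G" "y \<in> verts G" "f x = f y"
  shows "g x \<longleftrightarrow> g y"
  using assms unfolding connected_fibers_def by blast

lemma edge_verts: "fin_simple_graph G \<Longrightarrow> {x, y} \<in> edges G \<Longrightarrow> x \<in> verts G \<and> y \<in> verts G \<and> x \<noteq> y"
  unfolding fin_simple_graph_def by (cases "x = y") auto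

text \<open>Only the fibers of \<open>a\<close> and \<open>b\<close> are united, and the edge
  witnessing their adjacency connects the union.\<close>

lemma connected_fibers_merge:
  assumes G: "fin_simple_graph G" and f: "connected_fibers G f" and ab: "quotient_adj G f a b"
  shows "connected_fibers G (\<lambda>x. if f x = b then a else f x)"
  unfolding connected_fibers_def
proof (intro allI impI ballI)
  fix g :: "'a \<Rightarrow> bool" and x y
  assume g: "\<forall>x y. {x, y} \<in> edges G \<longrightarrow> (if f x = b then a else f x) = (if f y = b then a else f y) \<longrightarrow> g x = g y"
    and xy: "x \<in> verts G" "y \<in> verts G" "(if f x = b then a else f x) = (if f y = b then a else f y)"
  have fib: "g x = g y" if "x \<in> verts G" "y \<in> verts G" "f x = f y" for x y
    using f by (rule connected_fibersD) (use g that in auto)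
  obtain u v where uv: "{u, v} \<in> edges G" "f u = a" "f v = b" using ab by (auto simp: quotient_adj_def)
  then have "g u = g v" using g by auto
  moreover have "u \<in> verts G" "v \<in> verts G" using edge_verts[OF G uv(1)] by auto
  ultimately have "g x = g u" if "f x = a \<or> f x = b" "x \<in> verts G" for x
    using that fib[of x u] fib[of x v] uv by auto
  with fib[of x y] xy show "g x = g y" by (auto split: if_splits)
qed

definition label_cut :: "'w set \<Rightarrow> 'w \<Rightarrow> 'w \<Rightarrow> int" where
  "label_cut A a b = of_bool ((a \<in> A) \<noteq> (b \<in> A))"

lemma cut_ind_vimage: "x \<noteq> y \<Longrightarrow> cut_ind (f -` A) {x, y} = label_cut A (f x) (f y)"
  by (simp add: cut_ind_pair label_cut_def)

text \<open>A cut that avoids all edges inside the fibers is constant on each fiber, because fibers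
  are connected; it is therefore pulled back from the labels.\<close>

lemma cut_descend:
  assumes G: "fin_simple_graph G" and f: "connected_fibers G f"
    and A: "\<And>x y. {x, y} \<in> edges G \<Longrightarrow> f x = f y \<Longrightarrow> cut_ind A {x, y} = 0"
  shows "\<exists>B. \<forall>x y. {x, y} \<in> edges G \<longrightarrow> cut_ind A {x, y} = label_cut B (f x) (f y)"
proof -
  let ?B = "f ` (A \<inter> verts G)"
  have inA: "x \<in> A \<longleftrightarrow> y \<in> A" if "x \<in> verts G" "y \<in> verts G" "f x = f y" for x y
  proof (rule connected_fibersD[OF f _ that, of "\<lambda>x. x \<in> A"])
    fix x y assume e: "{x, y} \<in> edges G" "f x = f y"
    then have "x \<noteq> y" using edge_verts[OF G] by blast
    with A[OF e] show "x \<in> A \<longleftrightarrow> y \<in> A" by (simp add: cut_ind_pair)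
  qed
  have "cut_ind A {x, y} = label_cut ?B (f x) (f y)" if e: "{x, y} \<in> edges G" for x y
  proof -
    have v: "x \<in> verts G" "y \<in> verts G" "x \<noteq> y" using edge_verts[OF G e] by auto
    have "f z \<in> ?B \<longleftrightarrow> z \<in> A" if "z \<in> verts G" for z using inA that by blast
    with v show ?thesis by (simp add: cut_ind_pair label_cut_def)
  qed
  then show ?thesis by blast
qed

text \<open>Contraction restricts to the face of the cut cone where the contracted edges vanish.\<close>

lemma koszul_cuts_quotient:
  assumes G: "fin_simple_graph G" and f: "connected_fibers G f" and K: "koszul_cuts (edges G)"
    and eq: "\<And>a b. quotient_adj G f a b \<Longrightarrow>
      (\<Sum>k<Suc d. label_cut (L k) a b) = label_cut A a b + (\<Sum>k<Suc d. label_cut (M k) a b)"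
  shows "\<exists>Z N. \<forall>a b. quotient_adj G f a b \<longrightarrow> label_cut A a b \<le> label_cut Z a b \<and>
      (\<Sum>k<Suc d. label_cut (L k) a b) = label_cut Z a b + (\<Sum>k<d. label_cut (N k) a b)"
proof -
  have E: "\<exists>x y. e = {x, y} \<and> x \<noteq> y" if "e \<in> edges G" for e
    using G that unfolding fin_simple_graph_def by (metis card_2_iff)
  define w where "w e = (\<Sum>k<Suc d. cut_ind (f -` L k) e)" for e
  have w: "w {x, y} = (\<Sum>k<Suc d. label_cut (L k) (f x) (f y))" if "x \<noteq> y" for x y
    unfolding w_def cut_ind_vimage[OF that] ..
  have w1: "cut_sum (edges G) (Suc d) w" unfolding cut_sum_def w_def by (intro exI[of _ "\<lambda>k. f -` L k"]) blast
  have "w e - cut_ind (f -` A) e = (\<Sum>k<Suc d. cut_ind (f -` M k) e)" if e: "e \<in> edges G" for e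
  proof -
    obtain x y where xy: "e = {x, y}" "x \<noteq> y" using E[OF e] by blast
    then have "quotient_adj G f (f x) (f y)" using e unfolding quotient_adj_def by blast
    from eq[OF this] show ?thesis unfolding xy(1) w[OF xy(2)] cut_ind_vimage[OF xy(2)] by simp
  qed
  then have w2: "cut_sum (edges G) (Suc d) (\<lambda>e. w e - cut_ind (f -` A) e)"
    unfolding cut_sum_def by (intro exI[of _ "\<lambda>k. f -` M k"]) blast
  obtain Z h where Z: "\<And>e. e \<in> edges G \<Longrightarrow> cut_ind (f -` A) e \<le> cut_ind Z e"
    and h: "\<And>e. e \<in> edges G \<Longrightarrow> w e - cut_ind Z e = (\<Sum>k<d. cut_ind (h k) e)"
    using K[unfolded koszul_cuts_def, rule_format, OF w1 w2] unfolding cut_sum_def by blast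
  \<comment> \<open>\<open>w\<close> vanishes inside fibers and all summands are nonnegative, so
    each of them vanishes there and descends to the labels.\<close>
  have inner: "cut_ind Z {x, y} = 0 \<and> (\<forall>k<d. cut_ind (h k) {x, y} = 0)" if e: "{x, y} \<in> edges G" "f x = f y" for x y
  proof -
    have "x \<noteq> y" using edge_verts[OF G e(1)] by blast
    then have "w {x, y} = 0" using w e(2) by (simp add: label_cut_def)
    with h[OF e(1)] have 0: "cut_ind Z {x, y} + (\<Sum>k<d. cut_ind (h k) {x, y}) = 0" by simp
    have "0 \<le> (\<Sum>k<d. cut_ind (h k) {x, y})" by (intro sum_nonneg cut_ind_nonneg)
    with 0 have "cut_ind Z {x, y} = 0" "(\<Sum>k<d. cut_ind (h k) {x, y}) = 0"
      using cut_ind_nonneg[of Z "{x, y}"] by linarith+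
    then show ?thesis by (simp add: sum_nonneg_eq_0_iff cut_ind_nonneg)
  qed
  obtain Z' where Z': "\<And>x y. {x, y} \<in> edges G \<Longrightarrow> cut_ind Z {x, y} = label_cut Z' (f x) (f y)"
    using cut_descend[OF G f, of Z] inner by blast
  have "\<forall>k\<in>{..<d}. \<exists>B. \<forall>x y. {x, y} \<in> edges G \<longrightarrow> cut_ind (h k) {x, y} = label_cut B (f x) (f y)"
    using inner by (intro ballI cut_descend[OF G f]) auto
  from bchoice[OF this] obtain N where N: "\<forall>k\<in>{..<d}. \<forall>x y. {x, y} \<in> edges G \<longrightarrow> cut_ind (h k) {x, y} = label_cut (N k) (f x) (f y)"
    ..
  show ?thesis
  proof (intro exI[of _ Z'] exI[of _ N] allI impI)
    fix a b assume "quotient_adj G f a b"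
    then obtain x y where e: "{x, y} \<in> edges G" "f x = a" "f y = b" unfolding quotient_adj_def by blast
    then have ne: "x \<noteq> y" using edge_verts[OF G] by blast
    show "label_cut A a b \<le> label_cut Z' a b \<and>
      (\<Sum>k<Suc d. label_cut (L k) a b) = label_cut Z' a b + (\<Sum>k<d. label_cut (N k) a b)"
      using Z[OF e(1)] h[OF e(1)] N e unfolding w[OF ne] cut_ind_vimage[OF ne] Z'[OF e(1)] by simp
  qed
qed

lemma not_koszul_K4:
  assumes G: "fin_simple_graph G" and f: "connected_fibers G f"
    and dist: "distinct [c0, c1, c2, c3]" and ran: "f ` verts G \<subseteq> {c0, c1, c2, c3}"
    and adj: "quotient_adj G f c0 c1" "quotient_adj G f c0 c2" "quotient_adj G f c0 c3"
      "quotient_adj G f c1 c2" "quotient_adj G f c1 c3" "quotient_adj G f c2 c3"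
  shows "\<not> koszul_cuts (edges G)"
proof
  assume K: "koszul_cuts (edges G)"
  let ?L = "\<lambda>k. [{c0, c1}, {c0, c2}, {c0, c3}] ! k" and ?M = "\<lambda>k. [{c1}, {c2}, {c3}] ! k"
  have "(\<Sum>k<Suc 2. label_cut (?L k) a b) = label_cut {c0} a b + (\<Sum>k<Suc 2. label_cut (?M k) a b)"
    if "quotient_adj G f a b" for a b
  proof -
    from that obtain x y where e: "{x, y} \<in> edges G" "f x = a" "f y = b" unfolding quotient_adj_def by blast
    then have "a \<in> {c0, c1, c2, c3}" "b \<in> {c0, c1, c2, c3}" using edge_verts[OF G e(1)] ran by auto
    then show ?thesis using dist by (auto simp: label_cut_def numeral_2_eq_2)
  qed
  from koszul_cuts_quotient[OF G f K this]
  obtain Z N where ZN: "\<And>a b. quotient_adj G f a b \<Longrightarrow> label_cut {c0} a b \<le> label_cut Z a b \<and>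
      (\<Sum>k<Suc 2. label_cut (?L k) a b) = label_cut Z a b + (\<Sum>k<2::nat. label_cut (N k) a b)" by blast
  \<comment> \<open>Containing the star of \<open>c0\<close> forces \<open>Z\<close> to be that
    star, which leaves value 2 on each edge of the triangle \<open>c1\<close>, \<open>c2\<close>,
    \<open>c3\<close> for two cuts. Both would have to cut all three edges, but two of the corners
    lie on the same side of \<open>N 0\<close>.\<close>
  show False
    using adj[THEN ZN] dist
    by (cases "c1 \<in> N 0"; cases "c2 \<in> N 0"; cases "c3 \<in> N 0")
      (auto simp: label_cut_def numeral_2_eq_2 of_bool_def split: if_splits)
qed

lemma not_koszul_C5:
  assumes G: "fin_simple_graph G" and f: "connected_fibers G f"
    and dist: "distinct [c0, c1, c2, c3, c4]" and ran: "f ` verts G \<subseteq> {c0, c1, c2, c3, c4}"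
    and adj: "quotient_adj G f c0 c1" "quotient_adj G f c1 c2" "quotient_adj G f c2 c3"
      "quotient_adj G f c3 c4" "quotient_adj G f c4 c0"
    and chords: "\<not> quotient_adj G f c1 c3" "\<not> quotient_adj G f c2 c4" "\<not> quotient_adj G f c1 c4"
  shows "\<not> koszul_cuts (edges G)"
proof
  assume K: "koszul_cuts (edges G)"
  let ?L = "\<lambda>k. [{c2, c4}, {c1, c3}] ! k" and ?M = "\<lambda>k. [{c2}, {c3}] ! k"
  have "(\<Sum>k<Suc 1. label_cut (?L k) a b) = label_cut {c1, c4} a b + (\<Sum>k<Suc 1. label_cut (?M k) a b)"
    if q: "quotient_adj G f a b" for a b
  proof -
    from q obtain x y where e: "{x, y} \<in> edges G" "f x = a" "f y = b" unfolding quotient_adj_def by blast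
    then have "a \<in> {c0, c1, c2, c3, c4}" "b \<in> {c0, c1, c2, c3, c4}" using edge_verts[OF G e(1)] ran by auto
    then show ?thesis using dist q chords chords[THEN contrapos_nn, OF quotient_adj_sym]
      by (auto simp: label_cut_def)
  qed
  from koszul_cuts_quotient[OF G f K this]
  obtain Z N where ZN: "\<And>a b. quotient_adj G f a b \<Longrightarrow> label_cut {c1, c4} a b \<le> label_cut Z a b \<and>
      (\<Sum>k<Suc 1. label_cut (?L k) a b) = label_cut Z a b + (\<Sum>k<1::nat. label_cut (N k) a b)" by blast
  \<comment> \<open>On the pentagon \<open>Z\<close> contains the four edges cut by
    \<open>{c1, c4}\<close>, and by parity it misses the edge from \<open>c2\<close> to
    \<open>c3\<close>. That edge keeps the value 2, too much for the single cut left.\<close>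
  show False
    using adj[THEN ZN] dist
    by (auto simp: label_cut_def of_bool_def split: if_splits)
qed

text \<open>Two crossing chords yield \<open>K\<^sub>4\<close> by the contraction of a further edge; without them all
  chords meet in one vertex.\<close>

lemma not_koszul_pentagon:
  assumes G: "fin_simple_graph G" and f: "connected_fibers G f"
    and dist: "distinct [c0, c1, c2, c3, c4]" and ran: "f ` verts G \<subseteq> {c0, c1, c2, c3, c4}"
    and adj: "quotient_adj G f c0 c1" "quotient_adj G f c1 c2" "quotient_adj G f c2 c3"
      "quotient_adj G f c3 c4" "quotient_adj G f c4 c0"
  shows "\<not> koszul_cuts (edges G)"
proof
  assume K: "koszul_cuts (edges G)"
  have crossing: "\<not> (quotient_adj G f c0 c2 \<and> quotient_adj G f c1 c3)"
    if c: "distinct [c0, c1, c2, c3, c4]" "f ` verts G \<subseteq> {c0, c1, c2, c3, c4}"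
      "quotient_adj G f c0 c1" "quotient_adj G f c1 c2" "quotient_adj G f c2 c3"
      "quotient_adj G f c3 c4" "quotient_adj G f c4 c0" for c0 c1 c2 c3 c4
  proof
    assume ch: "quotient_adj G f c0 c2 \<and> quotient_adj G f c1 c3"
    let ?f = "\<lambda>x. if f x = c4 then c0 else f x"
    have lift: "quotient_adj G ?f a b" if "quotient_adj G f a b" "a \<noteq> c4" "b \<noteq> c4" for a b
      using that unfolding quotient_adj_def by fastforce
    have "quotient_adj G ?f c0 c3"
      using c(1) quotient_adj_sym[OF c(6)] unfolding quotient_adj_def by fastforce
    moreover have "connected_fibers G ?f" by (rule connected_fibers_merge[OF G f quotient_adj_sym[OF c(7)]])
    moreover have "distinct [c0, c1, c2, c3]" "?f ` verts G \<subseteq> {c0, c1, c2, c3}" using c(1,2) by auto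
    ultimately have "\<not> koszul_cuts (edges G)"
      using c ch by (intro not_koszul_K4[OF G, of ?f c0 c1 c2 c3]) (auto intro!: lift)
    with K show False by blast
  qed
  have fan: "quotient_adj G f c1 c3 \<or> quotient_adj G f c2 c4 \<or> quotient_adj G f c1 c4"
    if c: "distinct [c0, c1, c2, c3, c4]" "f ` verts G \<subseteq> {c0, c1, c2, c3, c4}"
      "quotient_adj G f c0 c1" "quotient_adj G f c1 c2" "quotient_adj G f c2 c3"
      "quotient_adj G f c3 c4" "quotient_adj G f c4 c0" for c0 c1 c2 c3 c4
    using not_koszul_C5[OF G f c] K by blast
  have rot: "distinct [c1, c2, c3, c4, c0]" "distinct [c2, c3, c4, c0, c1]" "distinct [c3, c4, c0, c1, c2]" "distinct [c4, c0, c1, c2, c3]"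
    "f ` verts G \<subseteq> {c1, c2, c3, c4, c0}" "f ` verts G \<subseteq> {c2, c3, c4, c0, c1}" "f ` verts G \<subseteq> {c3, c4, c0, c1, c2}" "f ` verts G \<subseteq> {c4, c0, c1, c2, c3}"
    using dist ran by auto
  note cr = crossing[OF dist ran adj] crossing[OF rot(1,5) adj(2-5,1)] crossing[OF rot(2,6) adj(3-5,1,2)]
    crossing[OF rot(3,7) adj(4,5,1-3)] crossing[OF rot(4,8) adj(5,1-4)]
  note fn = fan[OF dist ran adj] fan[OF rot(1,5) adj(2-5,1)] fan[OF rot(2,6) adj(3-5,1,2)]
    fan[OF rot(3,7) adj(4,5,1-3)] fan[OF rot(4,8) adj(5,1-4)]
  have sym: "quotient_adj G f a b \<longleftrightarrow> quotient_adj G f b a" for a b using quotient_adj_sym by metis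
  \<comment> \<open>Chords of a pentagon cross or share a vertex, and no three are pairwise
    noncrossing. Without crossings some vertex lies on all chords, against \<open>fn\<close> at that
    vertex.\<close>
  show False using cr fn sym[of c0 c2] sym[of c0 c3] sym[of c1 c3] sym[of c1 c4] sym[of c2 c4] by argo
qed

text \<open>Contractions act on the map \<open>f\<close>, deletions leave it alone. So edges of
  \<open>H\<close> are only implied to be adjacencies of the quotient, which may have more: the
  chords of the pentagon.\<close>

lemma reduces_to_quotient:
  assumes "reduces_to G H" "fin_simple_graph G"
  shows "fin_simple_graph H \<and> (\<exists>f. connected_fibers G f \<and> f ` verts G = verts H \<and>
    (\<forall>a b. {a, b} \<in> edges H \<longrightarrow> quotient_adj G f a b))"
  using assms
proof (induction rule: reduces_to.induct)
  case refl
  have "connected_fibers G (\<lambda>x. x)" by (simp add: connected_fibers_def)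
  moreover have "(\<lambda>x. x) ` verts G = verts G" by simp
  moreover have "\<forall>a b. {a, b} \<in> edges G \<longrightarrow> quotient_adj G (\<lambda>x. x) a b" by (auto simp: quotient_adj_def)
  ultimately show ?case using refl by blast
next
  case (delete H e)
  then show ?case by (auto simp: delete_edge_def fin_simple_graph_def)
next
  case (contract H x y)
  then obtain f where f: "connected_fibers G f" "f ` verts G = verts H" and H: "fin_simple_graph H"
    and lift: "\<And>a b. {a, b} \<in> edges H \<Longrightarrow> quotient_adj G f a b" by blast
  let ?f = "\<lambda>z. if f z = y then x else f z"
  have x: "x \<in> verts H" using edge_verts[OF H contract.hyps(2)] by blast
  have "connected_fibers G ?f" by (rule connected_fibers_merge[OF contract.prems f(1) lift[OF contract.hyps(2)]])
  moreover have "?f ` verts G = verts (contract_edge x y H)"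
  proof -
    have "?f ` verts G = (\<lambda>z. if z = y then x else z) ` verts H" unfolding f(2)[symmetric] image_image ..
    also have "\<dots> = verts H - {y}" using x contract.hyps(3) by auto
    finally show ?thesis by (simp add: contract_edge_def)
  qed
  moreover have "quotient_adj G ?f a b" if "{a, b} \<in> edges (contract_edge x y H)" for a b
  proof -
    have "card {a, b} = 2" and "\<exists>e\<in>edges H. {a, b} = (\<lambda>z. if z = y then x else z) ` e"
      using that by (auto simp: contract_edge_def)
    then obtain e where e: "e \<in> edges H" "{a, b} = (\<lambda>z. if z = y then x else z) ` e" by blast
    obtain p q where pq: "e = {p, q}" using e(1) H unfolding fin_simple_graph_def by (metis card_2_iff)
    obtain u v where uv: "{u, v} \<in> edges G" "f u = p" "f v = q"
      using lift e(1) unfolding pq quotient_adj_def by blast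
    have "{a, b} = {?f u, ?f v}" using e(2) uv unfolding pq by auto
    then consider "a = ?f u" "b = ?f v" | "a = ?f v" "b = ?f u" unfolding doubleton_eq_iff by blast
    then show ?thesis
    proof cases
      case 1 then show ?thesis using uv(1) unfolding quotient_adj_def by blast
    next
      case 2 then show ?thesis using uv(1) unfolding quotient_adj_def by (metis insert_commute)
    qed
  qed
  moreover have "fin_simple_graph (contract_edge x y H)"
    using H x contract.hyps(3) by (rule fin_simple_contract)
  ultimately show ?case by blast
qed

lemma is_minor_quotient:
  assumes "is_minor H G" "fin_simple_graph G"
  obtains f where "connected_fibers G f" "f ` verts G = verts H" "\<And>a b. {a, b} \<in> edges H \<Longrightarrow> a \<noteq> b \<Longrightarrow> quotient_adj G f a b"
proof -
  obtain G' where G': "reduces_to G G'" "graph_iso G' H" using assms(1) unfolding is_minor_def by blast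
  obtain h where h: "bij_betw h (verts G') (verts H)" "(\<lambda>e. h ` e) ` edges G' = edges H"
    using G'(2) unfolding graph_iso_def by blast
  obtain f where f: "connected_fibers G f" "f ` verts G = verts G'" and S: "fin_simple_graph G'"
    and lift: "\<And>a b. {a, b} \<in> edges G' \<Longrightarrow> quotient_adj G f a b"
    using reduces_to_quotient[OF G'(1) assms(2)] by blast
  have inj: "h (f x) = h (f y) \<longleftrightarrow> f x = f y" if "x \<in> verts G" "y \<in> verts G" for x y
    using h(1) f(2) that by (metis bij_betw_imp_inj_on imageI inj_on_eq_iff)
  have "connected_fibers G (h \<circ> f)"
    unfolding connected_fibers_def
  proof (intro allI impI ballI)
    fix g :: "'b \<Rightarrow> bool" and x y
    assume g: "\<forall>x y. {x, y} \<in> edges G \<longrightarrow> (h \<circ> f) x = (h \<circ> f) y \<longrightarrow> g x = g y"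
      and xy: "x \<in> verts G" "y \<in> verts G" "(h \<circ> f) x = (h \<circ> f) y"
    show "g x = g y" by (rule connected_fibersD[OF f(1) _ xy(1,2)]) (use g xy inj in auto)
  qed
  moreover have "(h \<circ> f) ` verts G = verts H" using h(1) f(2) by (metis bij_betw_imp_surj_on image_comp)
  moreover have "quotient_adj G (h \<circ> f) a b" if "{a, b} \<in> edges H" for a b
  proof -
    from that h(2) obtain e where e: "e \<in> edges G'" "{a, b} = h ` e" by blast
    obtain p q where pq: "e = {p, q}" using e(1) S unfolding fin_simple_graph_def by (metis card_2_iff)
    obtain u v where uv: "{u, v} \<in> edges G" "f u = p" "f v = q"
      using lift e(1) unfolding pq quotient_adj_def by blast
    have "{a, b} = {h (f u), h (f v)}" using e(2) uv unfolding pq by auto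
    then consider "a = h (f u)" "b = h (f v)" | "a = h (f v)" "b = h (f u)" unfolding doubleton_eq_iff by blast
    then show ?thesis
    proof cases
      case 1 then show ?thesis using uv(1) unfolding quotient_adj_def by auto
    next
      case 2 then show ?thesis using uv(1) unfolding quotient_adj_def comp_def by (metis insert_commute)
    qed
  qed
  ultimately show ?thesis using that by blast
qed

lemma not_koszul_if_K4_minor:
  assumes "is_minor (complete_graph 4) G" "fin_simple_graph G"
  shows "\<not> koszul_cuts (edges G)"
proof -
  obtain f where f: "connected_fibers G f" "f ` verts G = {..<4::nat}"
    and lift: "\<And>a b. {a, b} \<in> edges (complete_graph 4) \<Longrightarrow> a \<noteq> b \<Longrightarrow> quotient_adj G f a b"
    using is_minor_quotient[OF assms] by (auto simp: complete_graph_def)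
  have "{..<4::nat} = {0, 1, 2, 3}" by auto
  then show ?thesis using f(2)
    by (intro not_koszul_K4[OF assms(2) f(1), of 0 1 2 3] lift) (auto simp: complete_graph_def)
qed

lemma not_koszul_if_C5_minor:
  assumes "is_minor (cycle_graph 5) G" "fin_simple_graph G"
  shows "\<not> koszul_cuts (edges G)"
proof -
  obtain f where f: "connected_fibers G f" "f ` verts G = {..<5::nat}"
    and lift: "\<And>a b. {a, b} \<in> edges (cycle_graph 5) \<Longrightarrow> a \<noteq> b \<Longrightarrow> quotient_adj G f a b"
    using is_minor_quotient[OF assms] by (auto simp: cycle_graph_def)
  have step: "quotient_adj G f i ((i + 1) mod 5)" if i: "i < 5" for i
  proof (rule lift)
    show "{i, (i + 1) mod 5} \<in> edges (cycle_graph 5)" using i unfolding cycle_graph_def snd_conv by blast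
    show "i \<noteq> (i + 1) mod 5" using i by presburger
  qed
  have "quotient_adj G f 0 1" "quotient_adj G f 1 2" "quotient_adj G f 2 3" "quotient_adj G f 3 4" "quotient_adj G f 4 0"
    using step[of 0] step[of 1] step[of 2] step[of 3] step[of 4] by (simp_all add: numeral_2_eq_2)
  moreover have "{..<5::nat} = {0, 1, 2, 3, 4}" by auto
  ultimately show ?thesis using f(2)
    by (intro not_koszul_pentagon[OF assms(2) f(1), of 0 1 2 3 4]) simp_all
qed


section \<open>Monoid rings\<close>

text \<open>For a submonoid \<open>M\<close> this is the monoid algebra of \<open>M\<close>; for a
  subset closed under adding elements of \<open>M\<close> it is a monomial ideal.\<close>

definition span_in :: "'m set \<Rightarrow> ('m \<Rightarrow>\<^sub>0 'k::zero) set" where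
  "span_in M = {f. Poly_Mapping.keys f \<subseteq> M}"

lemma span_in_zero: "0 \<in> span_in M"
  by (simp add: span_in_def)

lemma span_in_add: "f \<in> span_in M \<Longrightarrow> g \<in> span_in M \<Longrightarrow> f + g \<in> span_in M"
  using keys_add[of f g] unfolding span_in_def by blast

lemma span_in_sum: "(\<And>i. i \<in> I \<Longrightarrow> f i \<in> span_in M) \<Longrightarrow> sum f I \<in> span_in M"
  by (induction I rule: infinite_finite_induct) (auto intro: span_in_zero span_in_add)

lemma span_in_uminus: "f \<in> span_in M \<Longrightarrow> - f \<in> span_in (M :: 'm set)" for f :: "'m \<Rightarrow>\<^sub>0 'k::ab_group_add"
  by (auto simp: span_in_def in_keys_iff)

lemma span_in_single: "m \<in> M \<Longrightarrow> Poly_Mapping.single m c \<in> span_in M"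
  by (simp add: span_in_def)

lemma span_in_single_iff: "Poly_Mapping.single m (1 :: 'k::zero_neq_one) \<in> span_in M \<longleftrightarrow> m \<in> M"
  by (simp add: span_in_def)

lemma span_in_mult:
  fixes f g :: "'m::monoid_add \<Rightarrow>\<^sub>0 'k::semiring_0"
  assumes "f \<in> span_in A" "g \<in> span_in B" "\<And>a b. a \<in> A \<Longrightarrow> b \<in> B \<Longrightarrow> a + b \<in> C"
  shows "f * g \<in> span_in C"
  using assms keys_mult[of f g] unfolding span_in_def by blast

locale monoid_ring =
  fixes R :: "('x, 'k::comm_ring_1) mpoly ring" and M :: "('x \<Rightarrow>\<^sub>0 nat) set"
  assumes R_eq: "R = ring_of_type_algebra\<lparr>carrier := span_in M\<rparr>"
    and ring_R: "cring R"
    and M_add: "\<And>m n. m \<in> M \<Longrightarrow> n \<in> M \<Longrightarrow> m + n \<in> M" and M_zero: "0 \<in> M"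
begin

sublocale R: cring R by (rule ring_R)

lemma R_simps: "carrier R = span_in M" "x \<otimes>\<^bsub>R\<^esub> y = x * y" "x \<oplus>\<^bsub>R\<^esub> y = x + y" "\<zero>\<^bsub>R\<^esub> = 0"
  by (simp_all add: R_eq ring_of_type_algebra_def)

lemma ideal_span:
  assumes I: "I \<subseteq> M" "\<And>m n. m \<in> M \<Longrightarrow> n \<in> I \<Longrightarrow> m + n \<in> I"
  shows "ideal (span_in I) R"
proof (rule idealI)
  have sub: "span_in I \<subseteq> carrier R" using I(1) unfolding R_simps span_in_def by blast
  show "subgroup (span_in I) (add_monoid R)"
  proof
    show "span_in I \<subseteq> carrier (add_monoid R)" using sub by simp
    show "x \<otimes>\<^bsub>add_monoid R\<^esub> y \<in> span_in I" if "x \<in> span_in I" "y \<in> span_in I" for x y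
      using that by (simp add: R_simps span_in_add)
    show "\<one>\<^bsub>add_monoid R\<^esub> \<in> span_in I" by (simp add: R_simps span_in_zero)
    show "inv\<^bsub>add_monoid R\<^esub> x \<in> span_in I" if "x \<in> span_in I" for x
    proof -
      have "\<ominus>\<^bsub>R\<^esub> x = - x"
        using that sub span_in_uminus[of x I] by (intro R.minus_equality) (auto simp: R_simps)
      then show ?thesis using that span_in_uminus[of x I] unfolding a_inv_def by simp
    qed
  qed
  show *: "x \<otimes>\<^bsub>R\<^esub> a \<in> span_in I" if "a \<in> span_in I" "x \<in> carrier R" for a x
    using that I(2) unfolding R_simps by (intro span_in_mult[of x M a I])
  show "a \<otimes>\<^bsub>R\<^esub> x \<in> span_in I" if "a \<in> span_in I" "x \<in> carrier R" for a x
    using *[OF that] unfolding R_simps by (simp add: mult.commute)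
qed (rule R.ring_axioms)

lemma multiple_single:
  fixes f :: "('x, 'k) mpoly"
  assumes "f \<in> span_in ((+) a ` M)"
  shows "\<exists>g\<in>span_in M. f = g * Poly_Mapping.single a 1"
proof -
  have "\<forall>m\<in>Poly_Mapping.keys f. \<exists>n. n \<in> M \<and> m = a + n" using assms unfolding span_in_def by blast
  from bchoice[OF this] obtain r where r: "\<forall>m\<in>Poly_Mapping.keys f. r m \<in> M \<and> m = a + r m" by blast
  let ?g = "\<Sum>m\<in>Poly_Mapping.keys f. Poly_Mapping.single (r m) (Poly_Mapping.lookup f m)"
  have "?g * Poly_Mapping.single a 1 = (\<Sum>m\<in>Poly_Mapping.keys f. Poly_Mapping.single (a + r m) (Poly_Mapping.lookup f m))"
    by (simp add: sum_distrib_right mult_single add.commute)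
  also have "\<dots> = (\<Sum>m\<in>Poly_Mapping.keys f. Poly_Mapping.single m (Poly_Mapping.lookup f m))"
    using r by (intro sum.cong) auto
  also have "\<dots> = f" by (rule mpoly_sum_single)
  finally have "f = ?g * Poly_Mapping.single a 1" by simp
  moreover have "?g \<in> span_in M" using r by (intro span_in_sum span_in_single) blast
  ultimately show ?thesis by blast
qed

lemma PIdl_single:
  assumes "a \<in> M"
  shows "PIdl\<^bsub>R\<^esub> (Poly_Mapping.single a 1) = span_in ((+) a ` M)"
proof
  show "PIdl\<^bsub>R\<^esub> (Poly_Mapping.single a 1) \<subseteq> span_in ((+) a ` M)"
    unfolding cgenideal_def R_simps
    by (auto intro!: span_in_mult[of _ M _ "{a}"] span_in_single simp: add.commute)
  show "span_in ((+) a ` M) \<subseteq> PIdl\<^bsub>R\<^esub> (Poly_Mapping.single a 1)"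
    unfolding cgenideal_def R_simps using multiple_single by blast
qed

lemma Idl_singles:
  assumes Z: "Z \<subseteq> M"
  shows "Idl\<^bsub>R\<^esub> ((\<lambda>z. Poly_Mapping.single z 1) ` Z) = span_in {z + m | z m. z \<in> Z \<and> m \<in> M}" (is "Idl\<^bsub>R\<^esub> ?B = span_in ?I")
proof
  have "?I \<subseteq> M" using Z M_add by blast
  then have I: "ideal (span_in ?I) R"
  proof (rule ideal_span)
    fix m n assume "m \<in> M" "n \<in> ?I"
    then obtain z m' where "n = z + m'" "z \<in> Z" "m' \<in> M" by blast
    moreover have "m + (z + m') = z + (m + m')" by (simp add: ac_simps)
    ultimately show "m + n \<in> ?I" using M_add[OF \<open>m \<in> M\<close>] by blast
  qed
  have "z \<in> ?I" if "z \<in> Z" for z using that M_zero by (metis (mono_tags, lifting) add.right_neutral mem_Collect_eq)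
  then show "Idl\<^bsub>R\<^esub> ?B \<subseteq> span_in ?I" using I by (intro R.genideal_minimal) (auto intro: span_in_single)
  have B: "?B \<subseteq> carrier R" using Z by (auto simp: R_simps intro: span_in_single)
  interpret J: ideal "Idl\<^bsub>R\<^esub> ?B" R by (rule R.genideal_ideal[OF B])
  show "span_in ?I \<subseteq> Idl\<^bsub>R\<^esub> ?B"
  proof
    fix f :: "('x, 'k) mpoly" assume f: "f \<in> span_in ?I"
    have mono: "Poly_Mapping.single m c \<in> Idl\<^bsub>R\<^esub> ?B" if m: "m \<in> ?I" for m c
    proof -
      obtain z n where zn: "m = z + n" "z \<in> Z" "n \<in> M" using m by blast
      have "Poly_Mapping.single n c \<otimes>\<^bsub>R\<^esub> Poly_Mapping.single z 1 \<in> Idl\<^bsub>R\<^esub> ?B"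
        using zn R.genideal_self[OF B] by (intro J.I_l_closed) (auto simp: R_simps intro: span_in_single)
      then show ?thesis by (simp add: R_simps mult_single zn add.commute)
    qed
    have "(\<Sum>m\<in>K. Poly_Mapping.single m (Poly_Mapping.lookup f m)) \<in> Idl\<^bsub>R\<^esub> ?B" if "finite K" "K \<subseteq> Poly_Mapping.keys f" for K
      using that
    proof (induction K rule: finite_induct)
      case empty
      show ?case using J.zero_closed by (simp add: R_simps)
    next
      case (insert m K)
      then have "Poly_Mapping.single m (Poly_Mapping.lookup f m) \<oplus>\<^bsub>R\<^esub>
          (\<Sum>m\<in>K. Poly_Mapping.single m (Poly_Mapping.lookup f m)) \<in> Idl\<^bsub>R\<^esub> ?B"
        using f by (intro J.a_closed mono) (auto simp: span_in_def)
      with insert show ?case by (simp add: R_simps)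
    qed
    from this[of "Poly_Mapping.keys f"] show "f \<in> Idl\<^bsub>R\<^esub> ?B" by (simp add: mpoly_sum_single)
  qed
qed

text \<open>The ideals involved are spanned by monomials, so strong Koszulness only depends on the monoid.\<close>

lemma strongly_koszul_monoid:
  fixes dg :: "('x \<Rightarrow>\<^sub>0 nat) \<Rightarrow> nat"
  assumes P: "P \<subseteq> M" and C: "C 2 = span_in {m \<in> M. dg m = 2}"
    and U: "U = (\<lambda>m. Poly_Mapping.single m 1) ` P"
  shows "strongly_koszul R C U \<longleftrightarrow> (\<forall>a\<in>P. \<forall>b\<in>P. a \<noteq> b \<longrightarrow> (\<forall>w\<in>(+) a ` M \<inter> (+) b ` M.
     \<exists>z\<in>(+) a ` M \<inter> (+) b ` M. dg z = 2 \<and> w \<in> (+) z ` M))" (is "_ \<longleftrightarrow> ?rhs")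
proof -
  have sub: "(+) a ` M \<subseteq> M" if "a \<in> P" for a using that P M_add by blast
  have inj: "Poly_Mapping.single a (1::'k) = Poly_Mapping.single b 1 \<longleftrightarrow> a = b" for a b :: "'x \<Rightarrow>\<^sub>0 nat"
    by (metis keys_single singleton_inject zero_neq_one)
  have int: "span_in A \<inter> span_in B = span_in (A \<inter> B)" for A B :: "('x \<Rightarrow>\<^sub>0 nat) set"
    by (auto simp: span_in_def)
  have key: "(\<exists>B \<subseteq> C 2. PIdl\<^bsub>R\<^esub> (Poly_Mapping.single a 1) \<inter> PIdl\<^bsub>R\<^esub> (Poly_Mapping.single b 1) = Idl\<^bsub>R\<^esub> B) \<longleftrightarrow>
    (\<forall>w\<in>(+) a ` M \<inter> (+) b ` M. \<exists>z\<in>(+) a ` M \<inter> (+) b ` M. dg z = 2 \<and> w \<in> (+) z ` M)"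
    (is "?L \<longleftrightarrow> ?R") if ab: "a \<in> P" "b \<in> P" for a b
  proof -
    define W where "W = (+) a ` M \<inter> (+) b ` M"
    define Z where "Z = {z \<in> W. dg z = 2}"
    have WM: "W \<subseteq> M" using sub ab by (auto simp: W_def)
    have W_add: "m + x \<in> W" if m: "m \<in> M" and x: "x \<in> W" for m x
    proof -
      obtain p q where pq: "x = a + p" "x = b + q" "p \<in> M" "q \<in> M" using x unfolding W_def by blast
      have "m + x = a + (m + p)" unfolding pq(1) by (simp add: ac_simps)
      moreover have "m + x = b + (m + q)" unfolding pq(2) by (simp add: ac_simps)
      ultimately show ?thesis unfolding W_def using M_add[OF m] pq(3,4) by blast
    qed
    have "a \<in> M" "b \<in> M" using ab P by auto
    then have I: "PIdl\<^bsub>R\<^esub> (Poly_Mapping.single a 1) \<inter> PIdl\<^bsub>R\<^esub> (Poly_Mapping.single b 1) = span_in W"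
      by (simp only: PIdl_single W_def int)
    have ZI: "Idl\<^bsub>R\<^esub> ((\<lambda>z. Poly_Mapping.single z 1) ` Z) = span_in {z + m | z m. z \<in> Z \<and> m \<in> M}"
      using WM by (intro Idl_singles) (auto simp: Z_def)
    have R_iff: "?R \<longleftrightarrow> W \<subseteq> {z + m | z m. z \<in> Z \<and> m \<in> M}" unfolding W_def[symmetric] Z_def by blast
    show ?thesis
    proof
      assume ?L
      then obtain B where B: "B \<subseteq> C 2" "span_in W = Idl\<^bsub>R\<^esub> B" unfolding I by blast
      have "C 2 \<subseteq> carrier R" unfolding C R_simps span_in_def by blast
      then have "B \<subseteq> span_in W" using B R.genideal_self[of B] by blast
      \<comment> \<open>The elements of \<open>B\<close> need not be monomials, but each of their
        monomials has degree 2 and lies in \<open>W\<close>. So the monomials in \<open>Z\<close>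
        already generate the intersection.\<close>
      then have "B \<subseteq> span_in Z" using B(1) unfolding C Z_def span_in_def by blast
      moreover have "Z \<subseteq> {z + m | z m. z \<in> Z \<and> m \<in> M}" using M_zero by force
      ultimately have "B \<subseteq> span_in {z + m | z m. z \<in> Z \<and> m \<in> M}" unfolding span_in_def by blast
      moreover have "ideal (span_in {z + m | z m. z \<in> Z \<and> m \<in> M}) R"
        unfolding ZI[symmetric] using WM by (intro R.genideal_ideal) (auto simp: R_simps Z_def intro: span_in_single)
      ultimately have "span_in W \<subseteq> (span_in {z + m | z m. z \<in> Z \<and> m \<in> M} :: ('x, 'k) mpoly set)"
        unfolding B(2) by (intro R.genideal_minimal)
      then have "x \<in> {z + m | z m. z \<in> Z \<and> m \<in> M}" if "x \<in> W" for x
        using span_in_single[OF that, of "1::'k"] span_in_single_iff[of x _, where ?'k = 'k] by blast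
      then show ?R unfolding R_iff by blast
    next
      assume ?R
      then have "W \<subseteq> {z + m | z m. z \<in> Z \<and> m \<in> M}" unfolding R_iff .
      moreover have "{z + m | z m. z \<in> Z \<and> m \<in> M} \<subseteq> W" using W_add by (force simp: Z_def add.commute)
      ultimately have "W = {z + m | z m. z \<in> Z \<and> m \<in> M}" by blast
      then have "span_in W = Idl\<^bsub>R\<^esub> ((\<lambda>z. Poly_Mapping.single z 1) ` Z)" unfolding ZI by simp
      moreover have "(\<lambda>z. Poly_Mapping.single z 1) ` Z \<subseteq> C 2" using WM unfolding C by (auto simp: Z_def intro!: span_in_single)
      ultimately show ?L unfolding I by blast
    qed
  qed
  show ?thesis unfolding strongly_koszul_def U using key by (simp add: inj)
qed

end


section \<open>The monoid of cut exponents\<close>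

definition cut_exponent :: "'v ugraph \<Rightarrow> 'v set set \<Rightarrow> ('v cut_var \<Rightarrow>\<^sub>0 nat)" where
  "cut_exponent G P = Poly_Mapping.single S 1 + (\<Sum>e\<in>cut_edges G P. Poly_Mapping.single (T e) 1)"

inductive_set cut_monoid :: "'v ugraph \<Rightarrow> ('v cut_var \<Rightarrow>\<^sub>0 nat) set" for G where
  zero: "0 \<in> cut_monoid G"
| add: "P \<in> cut_partitions G \<Longrightarrow> m \<in> cut_monoid G \<Longrightarrow> cut_exponent G P + m \<in> cut_monoid G"

lemma cut_monomial_eq:
  fixes G :: "'v ugraph"
  shows "cut_monomial G P = Poly_Mapping.single (cut_exponent G P) (1 :: 'k::comm_ring_1)"
proof -
  have "(\<Prod>e\<in>A. Var (T e)) = Poly_Mapping.single (\<Sum>e\<in>A. Poly_Mapping.single (T e) 1) (1::'k)" for A :: "'v set set"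
    by (induction A rule: infinite_finite_induct) (simp_all add: Var_def mult_single)
  then show ?thesis by (simp add: cut_monomial_def cut_exponent_def Var_def mult_single)
qed

lemma cut_monoid_add: "m \<in> cut_monoid G \<Longrightarrow> n \<in> cut_monoid G \<Longrightarrow> m + n \<in> cut_monoid G"
  by (induction rule: cut_monoid.induct) (auto simp: add.assoc intro: cut_monoid.add)

lemma cut_exponent_in: "P \<in> cut_partitions G \<Longrightarrow> cut_exponent G P \<in> cut_monoid G"
  using cut_monoid.add[OF _ cut_monoid.zero] by fastforce

text \<open>A substitution of monomials sends monomials to monomials, so its image is spanned by the
  monoid generated by the exponents of the generators.\<close>

lemma carrier_toric_ring: "carrier (toric_ring G :: ('v cut_var, 'k::comm_ring_1) mpoly ring) = span_in (cut_monoid G)"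
proof
  let ?H = "span_in (cut_monoid G) :: ('v cut_var, 'k) mpoly set"
  have mult: "f * g \<in> ?H" if "f \<in> ?H" "g \<in> ?H" for f g
    using that cut_monoid_add by (rule span_in_mult)
  have const: "Const c \<in> ?H" for c unfolding Const_def by (intro span_in_single cut_monoid.zero)
  have one: "1 \<in> ?H" using const[of 1] by simp
  have prod: "prod f I \<in> ?H" if "\<And>i. i \<in> I \<Longrightarrow> f i \<in> ?H" for f and I :: "'v set set set"
    using that by (induction I rule: infinite_finite_induct) (auto intro: one mult)
  have pow: "f ^ n \<in> ?H" if "f \<in> ?H" for f n using that by (induction n) (auto intro: one mult)
  have "cut_hom G p \<in> ?H" if p: "p \<in> polys_in (cut_partitions G)" for p
    unfolding cut_hom_def subst_hom_def
  proof (intro span_in_sum mult const prod pow)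
    fix m P assume "m \<in> Poly_Mapping.keys p" "P \<in> Poly_Mapping.keys m"
    then have "P \<in> cut_partitions G" using p unfolding polys_in_def by blast
    then show "cut_monomial G P \<in> ?H" unfolding cut_monomial_eq by (intro span_in_single cut_exponent_in)
  qed
  then show "carrier (toric_ring G) \<subseteq> ?H" by (auto simp: toric_ring_def)
  let ?I = "cut_hom G ` polys_in (cut_partitions G) :: ('v cut_var, 'k) mpoly set"
  have I_add: "f + g \<in> ?I" if fg: "f \<in> ?I" "g \<in> ?I" for f g
  proof -
    obtain p q where "f = cut_hom G p" "g = cut_hom G q" "p \<in> polys_in (cut_partitions G)" "q \<in> polys_in (cut_partitions G)"
      using fg by blast
    then show ?thesis by (intro image_eqI[of _ _ "p + q"]) (simp_all add: cut_hom_def subst_hom_add polys_in_add)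
  qed
  have I_mult: "f * g \<in> ?I" if fg: "f \<in> ?I" "g \<in> ?I" for f g
  proof -
    obtain p q where "f = cut_hom G p" "g = cut_hom G q" "p \<in> polys_in (cut_partitions G)" "q \<in> polys_in (cut_partitions G)"
      using fg by blast
    then show ?thesis by (intro image_eqI[of _ _ "p * q"]) (simp_all add: cut_hom_def subst_hom_mult polys_in_mult)
  qed
  have I_const: "Const c \<in> ?I" for c
    by (intro image_eqI[of _ _ "Const c"]) (simp_all add: cut_hom_def subst_hom_Const polys_in_Const)
  have I_gen: "cut_monomial G P \<in> ?I" if "P \<in> cut_partitions G" for P
  proof (rule image_eqI)
    show "cut_monomial G P = cut_hom G (Var P)" by (simp add: cut_hom_def subst_hom_Var)
    show "Var P \<in> polys_in (cut_partitions G)" using that by (simp add: polys_in_def Var_def)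
  qed
  have I_mono: "Poly_Mapping.single m c \<in> ?I" if "m \<in> cut_monoid G" for m c
    using that
  proof (induction rule: cut_monoid.induct)
    case zero
    show ?case using I_const[of c] by (simp add: Const_def)
  next
    case (add P m)
    have "cut_monomial G P * Poly_Mapping.single m c \<in> ?I" using add by (intro I_mult I_gen)
    then show ?case by (simp add: cut_monomial_eq mult_single)
  qed
  have I_sum: "sum f K \<in> ?I" if "\<And>i. i \<in> K \<Longrightarrow> f i \<in> ?I" for f and K :: "('v cut_var \<Rightarrow>\<^sub>0 nat) set"
    using that
  proof (induction K rule: infinite_finite_induct)
    case (insert x F)
    then show ?case by (simp add: I_add)
  qed (use I_const[of 0] in simp_all)
  have "f \<in> ?I" if "f \<in> ?H" for f
  proof -
    have "(\<Sum>m\<in>Poly_Mapping.keys f. Poly_Mapping.single m (Poly_Mapping.lookup f m)) \<in> ?I"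
      using that by (intro I_sum I_mono) (auto simp: span_in_def)
    then show ?thesis by (simp only: mpoly_sum_single)
  qed
  then show "?H \<subseteq> carrier (toric_ring G)" by (auto simp: toric_ring_def)
qed

lemma monoid_ring_toric: "monoid_ring (toric_ring G :: ('v cut_var, 'k::comm_ring_1) mpoly ring) (cut_monoid G)"
proof (rule monoid_ring.intro)
  show "toric_ring G = (ring_of_type_algebra\<lparr>carrier := span_in (cut_monoid G)\<rparr> :: ('v cut_var, 'k) mpoly ring)"
    using carrier_toric_ring[of G, where 'k = 'k] by (simp add: toric_ring_def)
qed (auto intro: toric_ring_cring cut_monoid_add cut_monoid.zero)

lemma strongly_koszul_toric_iff:
  "strongly_koszul (toric_ring G :: ('v cut_var, 'k::field) mpoly ring) (toric_component G) (toric_gens G) \<longleftrightarrow>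
   (\<forall>P\<in>cut_partitions G. \<forall>Q\<in>cut_partitions G. cut_exponent G P \<noteq> cut_exponent G Q \<longrightarrow>
     (\<forall>w\<in>(+) (cut_exponent G P) ` cut_monoid G \<inter> (+) (cut_exponent G Q) ` cut_monoid G.
       \<exists>z\<in>(+) (cut_exponent G P) ` cut_monoid G \<inter> (+) (cut_exponent G Q) ` cut_monoid G.
         Poly_Mapping.lookup z S = 2 \<and> w \<in> (+) z ` cut_monoid G))"
proof -
  interpret monoid_ring "toric_ring G :: ('v cut_var, 'k) mpoly ring" "cut_monoid G" by (rule monoid_ring_toric)
  show ?thesis
    by (subst strongly_koszul_monoid[where P = "cut_exponent G ` cut_partitions G" and dg = "\<lambda>m. Poly_Mapping.lookup m S"])
      (auto simp: toric_component_def carrier_toric_ring span_in_def toric_gens_def cut_monomial_eq image_image cut_exponent_in)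
qed

lemma cut_exponent_lookup:
  assumes "finite (edges G)"
  shows "Poly_Mapping.lookup (cut_exponent G P) S = 1"
    "Poly_Mapping.lookup (cut_exponent G P) (T e) = of_bool (e \<in> cut_edges G P)"
proof -
  have fin: "finite (cut_edges G P)" using assms by (simp add: cut_edges_def)
  show "Poly_Mapping.lookup (cut_exponent G P) S = 1"
    by (simp add: cut_exponent_def lookup_add lookup_sum lookup_single)
  have "(\<Sum>e'\<in>cut_edges G P. Poly_Mapping.lookup (Poly_Mapping.single (T e') 1) (T e)) = (\<Sum>e'\<in>cut_edges G P. of_bool (e' = e))"
    by (intro sum.cong) (auto simp: lookup_single when_def)
  then show "Poly_Mapping.lookup (cut_exponent G P) (T e) = of_bool (e \<in> cut_edges G P)"
    using fin by (simp add: cut_exponent_def lookup_add lookup_sum lookup_single when_def of_bool_def)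
qed

section \<open>Exponent vectors as sums of cuts\<close>

context
  fixes G :: "'v ugraph"
  assumes G: "fin_simple_graph G"
begin

lemma cut_ind_Int_verts: "e \<in> edges G \<Longrightarrow> cut_ind (A \<inter> verts G) e = cut_ind A e"
proof -
  assume "e \<in> edges G"
  then have "A \<inter> verts G \<inter> e = A \<inter> e" using G unfolding fin_simple_graph_def by blast
  then show ?thesis by (simp add: cut_ind_def)
qed

text \<open>\<open>A\<close> is not restricted to vertices of \<open>G\<close>, to match
  \<open>cut_ind\<close>; a set and its complement give the same partition.\<close>

definition cut_of :: "'v set \<Rightarrow> 'v set set" where
  "cut_of A = {A \<inter> verts G, verts G - A}"

lemma cut_of_in: "cut_of A \<in> cut_partitions G"
  unfolding cut_of_def cut_partitions_def by blast

lemma cut_partition_cases: "P \<in> cut_partitions G \<Longrightarrow> \<exists>A. P = cut_of A"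
proof -
  assume "P \<in> cut_partitions G"
  then obtain A B where "P = {A, B}" "A \<inter> B = {}" "A \<union> B = verts G" unfolding cut_partitions_def by blast
  then have "P = cut_of A" unfolding cut_of_def by blast
  then show ?thesis ..
qed

lemma cut_edges_cut_of: "cut_edges G (cut_of A) = {e \<in> edges G. cut_ind A e = 1}"
proof -
  have compl: "cut_ind (verts G - A) e = cut_ind A e" if "e \<in> edges G" for e
  proof -
    have "cut_ind (- A \<inter> verts G) e = cut_ind A e"
      using that G by (simp add: cut_ind_Int_verts cut_ind_Compl fin_simple_graph_def)
    then show ?thesis by (simp add: Diff_eq Int_commute)
  qed
  have "(\<exists>B\<in>cut_of A. card (B \<inter> e) = 1) \<longleftrightarrow> cut_ind A e = 1" if "e \<in> edges G" for e
  proof -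
    have "card (B \<inter> e) = 1 \<longleftrightarrow> cut_ind B e = 1" for B by (simp add: cut_ind_def)
    then show ?thesis using compl[OF that] cut_ind_Int_verts[OF that] by (simp add: cut_of_def)
  qed
  then show ?thesis unfolding cut_edges_def by blast
qed

lemma lookup_cut_of:
  "Poly_Mapping.lookup (cut_exponent G (cut_of A)) S = 1"
  "e \<in> edges G \<Longrightarrow> int (Poly_Mapping.lookup (cut_exponent G (cut_of A)) (T e)) = cut_ind A e"
  "e \<notin> edges G \<Longrightarrow> Poly_Mapping.lookup (cut_exponent G (cut_of A)) (T e) = 0"
  using cut_ind_cases[of A e] by (auto simp: cut_exponent_lookup[OF fin_simple_graph_finite_edges[OF G]] cut_edges_cut_of)

text \<open>Integer valued, so that the differences inside \<open>cut_sum\<close> are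
  genuine.\<close>

definition wt :: "('v cut_var \<Rightarrow>\<^sub>0 nat) \<Rightarrow> 'v set \<Rightarrow> int" where
  "wt m e = int (Poly_Mapping.lookup m (T e))"

text \<open>The indeterminates \<open>T e\<close> exist for all sets \<open>e\<close>. For supported
  exponents, the degree in \<open>S\<close> and the weights on edges determine everything.\<close>

definition supported :: "('v cut_var \<Rightarrow>\<^sub>0 nat) \<Rightarrow> bool" where
  "supported m \<longleftrightarrow> (\<forall>e. e \<notin> edges G \<longrightarrow> Poly_Mapping.lookup m (T e) = 0)"

lemma supported_eqI:
  assumes "supported m" "supported n" "Poly_Mapping.lookup m S = Poly_Mapping.lookup n S"
    "\<And>e. e \<in> edges G \<Longrightarrow> wt m e = wt n e"
  shows "m = n"
proof (rule poly_mapping_eqI)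
  fix x show "Poly_Mapping.lookup m x = Poly_Mapping.lookup n x"
    using assms by (cases x) (auto simp: wt_def supported_def, metis)
qed

lemma wt_add: "wt (m + n) e = wt m e + wt n e"
  by (simp add: wt_def lookup_add)

lemma supported_add: "supported m \<Longrightarrow> supported n \<Longrightarrow> supported (m + n)"
  by (simp add: supported_def lookup_add)

lemma wt_cut_of: "e \<in> edges G \<Longrightarrow> wt (cut_exponent G (cut_of A)) e = cut_ind A e"
  by (simp add: wt_def lookup_cut_of)

lemma supported_cut_of: "supported (cut_exponent G (cut_of A))"
  by (simp add: supported_def lookup_cut_of)

lemma cut_monoid_D:
  "m \<in> cut_monoid G \<Longrightarrow> supported m \<and> cut_sum (edges G) (Poly_Mapping.lookup m S) (wt m)"
proof (induction rule: cut_monoid.induct)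
  case zero
  show ?case by (simp add: supported_def wt_def)
next
  case (add P m)
  obtain A where A: "P = cut_of A" using cut_partition_cases[OF add(1)] ..
  have "cut_sum (edges G) (Poly_Mapping.lookup m S) (\<lambda>e. wt (cut_exponent G P + m) e - cut_ind A e)"
    using add.IH unfolding A by (simp add: wt_add wt_cut_of cong: cut_sum_cong)
  then have "cut_sum (edges G) (Suc (Poly_Mapping.lookup m S)) (wt (cut_exponent G P + m))"
    unfolding cut_sum_Suc by blast
  then show ?case using add.IH by (simp add: A supported_add supported_cut_of lookup_add lookup_cut_of)
qed

lemma cut_monoid_obtain:
  "cut_sum (edges G) d w \<Longrightarrow> \<exists>m\<in>cut_monoid G. Poly_Mapping.lookup m S = d \<and> (\<forall>e\<in>edges G. wt m e = w e)"
proof (induction d arbitrary: w)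
  case 0
  then show ?case by (intro bexI[of _ 0] cut_monoid.zero) (simp add: wt_def)
next
  case (Suc d)
  from Suc.prems obtain A where "cut_sum (edges G) d (\<lambda>e. w e - cut_ind A e)" unfolding cut_sum_Suc ..
  from Suc.IH[OF this] obtain m where m: "m \<in> cut_monoid G" "Poly_Mapping.lookup m S = d" "\<forall>e\<in>edges G. wt m e = w e - cut_ind A e"
    by blast
  have "cut_exponent G (cut_of A) + m \<in> cut_monoid G" by (rule cut_monoid.add[OF cut_of_in m(1)])
  then show ?case using m
    by (intro bexI[of _ "cut_exponent G (cut_of A) + m"]) (simp_all add: lookup_add lookup_cut_of wt_add wt_cut_of)
qed

text \<open>From left to right only intersections with the ideal of the empty cut are used; from
  right to left switching reduces an arbitrary pair of generators to such a pair.\<close>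

lemma strongly_koszul_iff_koszul_cuts:
  "strongly_koszul (toric_ring G :: ('v cut_var, 'k::field) mpoly ring) (toric_component G) (toric_gens G) \<longleftrightarrow>
    koszul_cuts (edges G)"
proof
  let ?M = "cut_monoid G" and ?x = "\<lambda>A. cut_exponent G (cut_of A)"
  have E: "card e = 2" if "e \<in> edges G" for e using G that by (simp add: fin_simple_graph_def)
  {
    assume sk: "strongly_koszul (toric_ring G :: ('v cut_var, 'k) mpoly ring) (toric_component G) (toric_gens G)"
    show "koszul_cuts (edges G)"
      unfolding koszul_cuts_def
    proof (intro allI impI)
      fix d w A assume w: "cut_sum (edges G) (Suc d) w" "cut_sum (edges G) (Suc d) (\<lambda>e. w e - cut_ind A e)"
      show "\<exists>Z. (\<forall>e\<in>edges G. cut_ind A e \<le> cut_ind Z e) \<and> cut_sum (edges G) d (\<lambda>e. w e - cut_ind Z e)"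
      \<comment> \<open>If \<open>A\<close> yields the same generator as the empty cut, strong
        Koszulness says nothing about the pair, but then \<open>A\<close> cuts no edge and any
        summand of \<open>w\<close> will do.\<close>
      proof (cases "?x A = ?x {}")
        case True
        then have A0: "cut_ind A e = 0" if "e \<in> edges G" for e
          using wt_cut_of[OF that, of A] wt_cut_of[OF that, of "{}"] by simp
        obtain Z where "cut_sum (edges G) d (\<lambda>e. w e - cut_ind Z e)" using w(1) unfolding cut_sum_Suc ..
        with A0 cut_ind_nonneg show ?thesis by (intro exI[of _ Z]) auto
      next
        case False
        obtain m1 where m1: "m1 \<in> ?M" "Poly_Mapping.lookup m1 S = Suc d" "\<forall>e\<in>edges G. wt m1 e = w e"
          using cut_monoid_obtain[OF w(1)] by blast
        obtain m2 where m2: "m2 \<in> ?M" "Poly_Mapping.lookup m2 S = Suc d" "\<forall>e\<in>edges G. wt m2 e = w e - cut_ind A e"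
          using cut_monoid_obtain[OF w(2)] by blast
        have "?x {} + m1 = ?x A + m2"
          using cut_monoid_D[OF m1(1)] cut_monoid_D[OF m2(1)] m1 m2
          by (intro supported_eqI supported_add supported_cut_of) (simp_all add: wt_add wt_cut_of lookup_add lookup_cut_of)
        then have "?x {} + m1 \<in> (+) (?x A) ` ?M \<inter> (+) (?x {}) ` ?M" using m1(1) m2(1) by blast
        then obtain z where z: "z \<in> (+) (?x A) ` ?M \<inter> (+) (?x {}) ` ?M" "Poly_Mapping.lookup z S = 2"
          "?x {} + m1 \<in> (+) z ` ?M"
          using sk[unfolded strongly_koszul_toric_iff, rule_format, OF cut_of_in cut_of_in False] by blast
        from z(1,3) obtain z1 z2 m where z1: "z = ?x {} + z1" "z1 \<in> ?M" and z2: "z = ?x A + z2"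
          and m: "?x {} + m1 = z + m" "m \<in> ?M" by blast
        \<comment> \<open>One of the two degrees of \<open>z\<close> belongs to the empty cut, so
          the rest \<open>z1\<close> is a single cut \<open>Z\<close>. The other factorisation of
          \<open>z\<close> shows that \<open>Z\<close> contains \<open>A\<close>.\<close>
        have "Poly_Mapping.lookup z1 S = Suc 0" using z(2) unfolding z1(1) by (simp add: lookup_add lookup_cut_of)
        with cut_monoid_D[OF z1(2)] obtain Z where Z: "\<forall>e\<in>edges G. wt z1 e - cut_ind Z e = 0"
          by (auto simp: cut_sum_Suc)
        have "cut_ind A e \<le> cut_ind Z e" if e: "e \<in> edges G" for e
        proof -
          have "wt (?x {} + z1) e = wt (?x A + z2) e" using z1(1) z2 by simp
          then have "cut_ind Z e = cut_ind A e + wt z2 e" using Z e by (simp add: wt_add wt_cut_of)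
          then show ?thesis by (simp add: wt_def)
        qed
        moreover have "cut_sum (edges G) d (\<lambda>e. w e - cut_ind Z e)"
        proof -
          have "Poly_Mapping.lookup (?x {} + m1) S = Poly_Mapping.lookup (z + m) S" using m(1) by simp
          then have "Poly_Mapping.lookup m S = d" using z(2) m1(2) by (simp add: lookup_add lookup_cut_of)
          moreover have "wt m e = w e - cut_ind Z e" if e: "e \<in> edges G" for e
          proof -
            have "wt (?x {} + m1) e = wt (?x {} + z1 + m) e" using m(1) z1(1) by simp
            then show ?thesis using Z m1(3) e by (simp add: wt_add wt_cut_of)
          qed
          moreover have "cut_sum (edges G) (Poly_Mapping.lookup m S) (wt m)" using cut_monoid_D[OF m(2)] ..
          ultimately show ?thesis by (metis (no_types, lifting) cut_sum_cong)
        qed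
        ultimately show ?thesis by blast
      qed
    qed
  }
  assume K: "koszul_cuts (edges G)"
  show "strongly_koszul (toric_ring G :: ('v cut_var, 'k) mpoly ring) (toric_component G) (toric_gens G)"
    unfolding strongly_koszul_toric_iff
  proof (intro ballI impI)
    fix P Q w assume PQ: "P \<in> cut_partitions G" "Q \<in> cut_partitions G" "cut_exponent G P \<noteq> cut_exponent G Q"
      and w: "w \<in> (+) (cut_exponent G P) ` ?M \<inter> (+) (cut_exponent G Q) ` ?M"
    obtain A A' where A: "P = cut_of A" "Q = cut_of A'" using PQ cut_partition_cases by blast
    obtain m1 m2 where m1: "w = ?x A + m1" "m1 \<in> ?M" and m2: "w = ?x A' + m2" "m2 \<in> ?M" using w unfolding A by blast
    have deg: "Poly_Mapping.lookup m1 S = Poly_Mapping.lookup m2 S"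
      using m1(1) m2(1) by (metis add_left_cancel lookup_add lookup_cut_of(1))
    \<comment> \<open>In degree 0 both cofactors would be trivial and the two generators equal;
      hence there is a predecessor \<open>d\<close>.\<close>
    have "Poly_Mapping.lookup m1 S \<noteq> 0"
    proof
      assume 0: "Poly_Mapping.lookup m1 S = 0"
      have "?x A = ?x A'"
      proof (rule supported_eqI)
        fix e assume e: "e \<in> edges G"
        have "wt m1 e = 0" "wt m2 e = 0" using cut_monoid_D[OF m1(2)] cut_monoid_D[OF m2(2)] 0 deg e by auto
        then show "wt (?x A) e = wt (?x A') e" using m1(1) m2(1) wt_add[of _ _ e] by (metis add.right_neutral)
      qed (simp_all add: supported_cut_of lookup_cut_of)
      with PQ(3) A show False by simp
    qed
    then obtain d where d: "Poly_Mapping.lookup m1 S = Suc d" by (cases "Poly_Mapping.lookup m1 S") auto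
    have wts: "wt w e = cut_ind A e + wt m1 e" "wt w e = cut_ind A' e + wt m2 e" if "e \<in> edges G" for e
      using wt_add[of "?x A" m1 e] wt_add[of "?x A'" m2 e] m1(1) m2(1) by (simp_all add: wt_cut_of[OF that])
    have c1: "cut_sum (edges G) (Suc d) (\<lambda>e. wt w e - cut_ind A e)"
      using cut_monoid_D[OF m1(2)] wts(1) unfolding d by (simp cong: cut_sum_cong)
    have c2: "cut_sum (edges G) (Suc d) (\<lambda>e. wt w e - cut_ind A' e)"
      using cut_monoid_D[OF m2(2)] wts(2) unfolding deg[symmetric] d by (simp cong: cut_sum_cong)
    obtain B B' where B: "\<And>e. e \<in> edges G \<Longrightarrow> cut_ind A e + cut_ind B e = cut_ind A' e + cut_ind B' e"
      and cs: "cut_sum (edges G) d (\<lambda>e. wt w e - cut_ind A e - cut_ind B e)"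
      by (rule koszul_cuts_switch[OF E K c1 c2]) blast+
    obtain m where m: "m \<in> ?M" "Poly_Mapping.lookup m S = d" "\<forall>e\<in>edges G. wt m e = wt w e - cut_ind A e - cut_ind B e"
      using cut_monoid_obtain[OF cs] by blast
    have z: "?x A + ?x B = ?x A' + ?x B'"
      using B by (intro supported_eqI supported_add supported_cut_of) (simp_all add: wt_add wt_cut_of lookup_add lookup_cut_of)
    have "supported w" unfolding m1(1) using cut_monoid_D[OF m1(2)] by (intro supported_add supported_cut_of) blast
    then have "w = ?x A + ?x B + m"
    proof (rule supported_eqI)
      show "supported (?x A + ?x B + m)" using cut_monoid_D[OF m(1)] by (intro supported_add supported_cut_of) blast
      show "Poly_Mapping.lookup w S = Poly_Mapping.lookup (?x A + ?x B + m) S"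
        unfolding m1(1) by (simp add: lookup_add lookup_cut_of d m(2))
      show "wt w e = wt (?x A + ?x B + m) e" if "e \<in> edges G" for e
        using m(3) that by (simp add: wt_add wt_cut_of)
    qed
    then have "w \<in> (+) (?x A + ?x B) ` ?M" using m(1) by blast
    moreover have "?x A + ?x B \<in> (+) (?x A) ` ?M \<inter> (+) (?x A') ` ?M"
      using z cut_exponent_in[OF cut_of_in] by blast
    moreover have "Poly_Mapping.lookup (?x A + ?x B) S = 2" by (simp add: lookup_add lookup_cut_of)
    ultimately show "\<exists>z\<in>(+) (cut_exponent G P) ` ?M \<inter> (+) (cut_exponent G Q) ` ?M.
        Poly_Mapping.lookup z S = 2 \<and> w \<in> (+) z ` ?M"
      unfolding A by blast
  qed
qed

end


section \<open>Strongly Koszul cut ideals\<close>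

theorem theorem3p3:
  fixes G :: "'v ugraph"
  assumes "fin_simple_graph G" and "connected_graph G"
  shows "strongly_koszul (toric_ring G :: ('v cut_var, 'k::field) mpoly ring)
           (toric_component G) (toric_gens G)
         \<longleftrightarrow> \<not> is_minor (complete_graph 4) G \<and> \<not> is_minor (cycle_graph 5) G"
proof -
  let ?E = "edges G"
  have E: "finite ?E" "\<And>e. e \<in> ?E \<Longrightarrow> card e = 2"
    using assms(1) by (auto simp: fin_simple_graph_finite_edges) (simp add: fin_simple_graph_def)
  have "koszul_cuts ?E" if minor: "\<not> is_minor (complete_graph 4) G" "\<not> is_minor (cycle_graph 5) G"
  proof (rule koszul_cuts_if_no_long_cycle[OF E])
    show "length vs < 5" if "cyclic ?E vs" for vs
      using C5_minor_if_long_cycle[OF assms that] minor(2) by force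
    show "k4_free ?E" by (rule k4_free_if_no_minor[OF assms minor(1)])
  qed
  moreover have "\<not> koszul_cuts ?E" if "is_minor (complete_graph 4) G"
    using not_koszul_if_K4_minor[OF that assms(1)] .
  moreover have "\<not> koszul_cuts ?E" if "is_minor (cycle_graph 5) G"
    using not_koszul_if_C5_minor[OF that assms(1)] .
  ultimately show ?thesis
    unfolding strongly_koszul_iff_koszul_cuts[OF assms(1)] by blast
qed

end
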